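(* If $X$ is a reflexive infinite-dimensional real Banach lattice, then the closed unit ball $\mathbf B(X)$ has uncountably many order extreme points.
   Context: A point $a\in A$ is an order extreme point of $A$ if for all $x_0,x_1\in A$ and $t\in(0,1)$, $a\le(1-t)x_0+tx_1$ implies $x_0=a=x_1$. *)

theory Defs
  imports "HOL-Analysis.Analysis"
begin

definition lat_abs :: "'a::{ab_group_add,lattice} \<Rightarrow> 'a" where
  "lat_abs x = sup x (- x)"

definition banach_lattice :: "'a::{banach,lattice} itself \<Rightarrow> bool" where
  "banach_lattice _ \<longleftrightarrow>
     (\<forall>x y z::'a. x \<le> y \<longrightarrow> x + z \<le> y + z) \<and>
     (\<forall>(x::'a) y (c::real). x \<le> y \<and> 0 \<le> c \<longrightarrow> c *\<^sub>R x \<le> c *\<^sub>R y) \<and>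
     (\<forall>x y::'a. lat_abs x \<le> lat_abs y \<longrightarrow> norm x \<le> norm y)"

definition reflexive_space :: "'a::banach itself \<Rightarrow> bool" where
  "reflexive_space _ \<longleftrightarrow>
     (\<forall>\<phi> :: ('a \<Rightarrow>\<^sub>L real) \<Rightarrow>\<^sub>L real. \<exists>x::'a. \<forall>f. blinfun_apply \<phi> f = blinfun_apply f x)"

definition infinite_dimensional :: "'a::real_vector itself \<Rightarrow> bool" where
  "infinite_dimensional _ \<longleftrightarrow> (\<exists>S::'a set. independent S \<and> infinite S)"

definition order_extreme_point :: "'a::{real_vector,order} set \<Rightarrow> 'a \<Rightarrow> bool" where
  "order_extreme_point A a \<longleftrightarrow> a \<in> A \<and>
     (\<forall>x0\<in>A. \<forall>x1\<in>A. \<forall>t::real. 0 < t \<and> t < 1 \<and> a \<le> (1 - t) *\<^sub>R x0 + t *\<^sub>R x1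
        \<longrightarrow> x0 = a \<and> x1 = a)"

end

theory Submission
  imports Defs "HOL-Library.Lattice_Algebras"
begin

text \<open>Let \<open>K\<close> be the set of positive functionals of norm at most 1, a compact space in the weak* topology.
  By weak compactness of the ball, every positive functional attains its maximum over the ball at an order
  extreme point: a minimal weakly closed ``order face'' is a singleton, because positive functionals are constant
  on it and separate points. Suppose there are only countably many order extreme points \<open>a\<close>. The sets
  \<open>{f \<in> K. f a \<noteq> 1}\<close> are open and dense in \<open>K\<close> (shrink \<open>f\<close>). The sphere of \<open>K\<close> is a dense countable intersection of
  open sets: it suffices to find positive norm-one functionals that are arbitrarily small at a given \<open>e \<ge> 0\<close>.
  If there were none, \<open>e\<close> would be an order unit; then the partial sums of an infinite disjoint normalised
  sequence would be bounded, increasing and not Cauchy, contrary to reflexivity. By Baire some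
  norm-one \<open>f \<in> K\<close> has \<open>f a \<noteq> 1\<close> for every order extreme point \<open>a\<close>, a contradiction.\<close>

subsection \<open>The Hahn--Banach theorem for sublinear functionals\<close>

definition sublinear :: "('a::real_vector \<Rightarrow> real) \<Rightarrow> bool" where
  "sublinear p \<longleftrightarrow> (\<forall>x y. p (x + y) \<le> p x + p y) \<and> (\<forall>c x. 0 \<le> c \<longrightarrow> p (c *\<^sub>R x) = c * p x)"

lemma sublinear_add: "sublinear p \<Longrightarrow> p (x + y) \<le> p x + p y"
  by (simp add: sublinear_def)

lemma sublinear_scaleR: "sublinear p \<Longrightarrow> 0 \<le> c \<Longrightarrow> p (c *\<^sub>R x) = c * p x"
  by (simp add: sublinear_def)

lemma sublinear_zero: "sublinear p \<Longrightarrow> p 0 = 0"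
  using sublinear_scaleR[of p 0 0] by simp

lemma sublinear_minus: "sublinear p \<Longrightarrow> - p (- x) \<le> p x"
  using sublinear_add[of p x "- x"] sublinear_zero[of p] by simp

text \<open>Applying the one-sided scaling bound to \<open>1/c\<close> and
  \<open>c *\<^sub>R x\<close> gives the reverse inequality, so equality comes for free.\<close>

lemma sublinearI:
  assumes "\<And>x y. p (x + y) \<le> p x + p y" "\<And>c x. 0 < c \<Longrightarrow> p (c *\<^sub>R x) \<le> c * p x" "p 0 = 0"
  shows "sublinear p"
  unfolding sublinear_def
proof (intro conjI allI impI)
  fix c :: real and x assume "0 \<le> c"
  show "p (c *\<^sub>R x) = c * p x"
  proof (cases "c = 0")
    case False
    with \<open>0 \<le> c\<close> have c: "0 < c" by simp
    have "p x = p ((1/c) *\<^sub>R (c *\<^sub>R x))" using c by simp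
    also have "\<dots> \<le> (1/c) * p (c *\<^sub>R x)" using c by (intro assms) simp
    finally have "c * p x \<le> p (c *\<^sub>R x)" using c by (simp add: field_simps)
    with assms(2)[OF c] show ?thesis by (simp add: order.antisym)
  qed (simp add: assms)
qed (use assms in auto)

text \<open>Replacing \<open>p\<close> by \<open>sublinear_shift p y\<close> forces linearity in the direction \<open>y\<close>.\<close>

definition sublinear_shift :: "('a::real_vector \<Rightarrow> real) \<Rightarrow> 'a \<Rightarrow> 'a \<Rightarrow> real" where
  "sublinear_shift p y x = (INF t\<in>{0..}. p (x + t *\<^sub>R y) - t * p y)"

text \<open>The lower bound \<open>- p (- x)\<close> does not depend on \<open>t\<close>; it makes
  the real-valued \<open>INF\<close> a genuine infimum.\<close>

lemma sublinear_shift_bdd: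
  assumes "sublinear p"
  shows "bdd_below ((\<lambda>t. p (x + t *\<^sub>R y) - t * p y) ` {0..})"
proof (rule bdd_belowI2)
  fix t :: real assume "t \<in> {0..}"
  then have "t * p y = p ((x + t *\<^sub>R y) + (- x))"
    using assms by (simp add: sublinear_scaleR)
  also have "\<dots> \<le> p (x + t *\<^sub>R y) + p (- x)" by (rule sublinear_add[OF assms])
  finally show "- p (- x) \<le> p (x + t *\<^sub>R y) - t * p y" by simp
qed

lemma sublinear_shift_le:
  assumes "sublinear p" "0 \<le> t"
  shows "sublinear_shift p y x \<le> p (x + t *\<^sub>R y) - t * p y"
  unfolding sublinear_shift_def using assms
  by (intro cINF_lower sublinear_shift_bdd) auto

lemma sublinear_shift_greatest:
  assumes "\<And>t. 0 \<le> t \<Longrightarrow> c \<le> p (x + t *\<^sub>R y) - t * p y"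
  shows "c \<le> sublinear_shift p y x"
  unfolding sublinear_shift_def using assms by (intro cINF_greatest) auto

lemma sublinear_shift_le_self: "sublinear p \<Longrightarrow> sublinear_shift p y x \<le> p x"
  using sublinear_shift_le[of p 0 y x] by simp

lemma sublinear_shift:
  assumes p: "sublinear p"
  shows "sublinear (sublinear_shift p y)"
proof (rule sublinearI)
  fix x x' :: 'a
  have *: "sublinear_shift p y (x + x') \<le> (p (x + t *\<^sub>R y) - t * p y) + (p (x' + t' *\<^sub>R y) - t' * p y)"
    if "0 \<le> t" "0 \<le> t'" for t t'
  proof -
    have "sublinear_shift p y (x + x') \<le> p ((x + x') + (t + t') *\<^sub>R y) - (t + t') * p y"
      using that by (intro sublinear_shift_le[OF p]) simp
    also have "(x + x') + (t + t') *\<^sub>R y = (x + t *\<^sub>R y) + (x' + t' *\<^sub>R y)"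
      by (simp add: algebra_simps)
    finally show ?thesis
      using sublinear_add[OF p, of "x + t *\<^sub>R y" "x' + t' *\<^sub>R y"] by (simp add: algebra_simps)
  qed
  have "sublinear_shift p y (x + x') - (p (x + t *\<^sub>R y) - t * p y) \<le> sublinear_shift p y x'"
    if "0 \<le> t" for t
    using *[OF that] by (intro sublinear_shift_greatest) (simp add: algebra_simps)
  then have "sublinear_shift p y (x + x') - sublinear_shift p y x' \<le> sublinear_shift p y x"
    by (intro sublinear_shift_greatest) (simp add: algebra_simps)
  then show "sublinear_shift p y (x + x') \<le> sublinear_shift p y x + sublinear_shift p y x'"
    by simp
next
  fix c :: real and x :: 'a assume c: "0 < c"
  have "sublinear_shift p y (c *\<^sub>R x) / c \<le> sublinear_shift p y x"
  proof (rule sublinear_shift_greatest)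
    fix t :: real assume t: "0 \<le> t"
    have "sublinear_shift p y (c *\<^sub>R x) \<le> p (c *\<^sub>R x + (c * t) *\<^sub>R y) - (c * t) * p y"
      using t c by (intro sublinear_shift_le[OF p]) simp
    also have "c *\<^sub>R x + (c * t) *\<^sub>R y = c *\<^sub>R (x + t *\<^sub>R y)"
      by (simp add: algebra_simps)
    also have "p \<dots> = c * p (x + t *\<^sub>R y)"
      using c by (intro sublinear_scaleR[OF p]) simp
    finally show "sublinear_shift p y (c *\<^sub>R x) / c \<le> p (x + t *\<^sub>R y) - t * p y"
      using c by (simp add: field_simps)
  qed
  then show "sublinear_shift p y (c *\<^sub>R x) \<le> c * sublinear_shift p y x"
    using c by (simp add: field_simps)
next
  have "0 \<le> sublinear_shift p y 0"
    using sublinear_scaleR[OF p] by (intro sublinear_shift_greatest) simp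
  moreover have "sublinear_shift p y 0 \<le> 0"
    using sublinear_shift_le_self[OF p, of y 0] sublinear_zero[OF p] by simp
  ultimately show "sublinear_shift p y 0 = 0" by simp
qed

text \<open>Lower bounds for Zorn's lemma. All members lie above \<open>- p (- x)\<close> at
  \<open>x\<close>, so the pointwise infimum is finite.\<close>

lemma sublinear_INF_chain:
  assumes ne: "C \<noteq> {}" and C: "\<And>q. q \<in> C \<Longrightarrow> sublinear q \<and> (\<forall>x. q x \<le> p x)"
    and chain: "\<And>q r. q \<in> C \<Longrightarrow> r \<in> C \<Longrightarrow> (\<forall>x. q x \<le> r x) \<or> (\<forall>x. r x \<le> q x)"
  defines "m \<equiv> \<lambda>x. INF q\<in>C. q x"
  shows "sublinear m" "\<And>q x. q \<in> C \<Longrightarrow> m x \<le> q x"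
proof -
  have bdd: "bdd_below ((\<lambda>q. q x) ` C)" for x
  proof (rule bdd_belowI2)
    fix q assume "q \<in> C"
    with C have "sublinear q" "q (- x) \<le> p (- x)" by auto
    then show "- p (- x) \<le> q x" using sublinear_minus[of q x] by linarith
  qed
  show le: "m x \<le> q x" if "q \<in> C" for q x
    unfolding m_def by (rule cINF_lower[OF bdd that])
  have gr: "c \<le> m x" if "\<And>q. q \<in> C \<Longrightarrow> c \<le> q x" for c x
    unfolding m_def by (rule cINF_greatest[OF ne that])
  show "sublinear m"
  proof (rule sublinearI)
    fix x y
    have *: "m (x + y) \<le> q x + r y" if qr: "q \<in> C" "r \<in> C" for q r
    proof -
      \<comment> \<open>The chain condition enters here: the smaller of \<open>q\<close> and
        \<open>r\<close> serves both arguments at once, so its subadditivity can be used.\<close>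
      obtain u where u: "u \<in> C" "u x \<le> q x" "u y \<le> r y"
        using chain[OF qr] qr by (meson order.refl)
      have "m (x + y) \<le> u (x + y)" by (rule le[OF u(1)])
      also have "\<dots> \<le> u x + u y" using C[OF u(1)] sublinear_add by blast
      finally show ?thesis using u by linarith
    qed
    have "m (x + y) - q x \<le> m y" if "q \<in> C" for q
      using *[OF that] by (intro gr) (simp add: algebra_simps)
    then have "m (x + y) - m y \<le> m x"
      by (intro gr) (simp add: algebra_simps)
    then show "m (x + y) \<le> m x + m y" by simp
  next
    fix c :: real and x assume c: "0 < c"
    have "m (c *\<^sub>R x) / c \<le> m x"
    proof (rule gr)
      fix q assume q: "q \<in> C"
      have "m (c *\<^sub>R x) \<le> c * q x"
        using le[OF q, of "c *\<^sub>R x"] C[OF q] c by (simp add: sublinear_scaleR)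
      then show "m (c *\<^sub>R x) / c \<le> q x" using c by (simp add: field_simps)
    qed
    then show "m (c *\<^sub>R x) \<le> c * m x" using c by (simp add: field_simps)
  next
    have z: "q 0 = 0" if "q \<in> C" for q using C[OF that] sublinear_zero by blast
    obtain q where "q \<in> C" using ne by blast
    then have "m 0 \<le> 0" using le[of q 0] z[of q] by simp
    moreover have "0 \<le> m 0" by (rule gr) (simp add: z)
    ultimately show "m 0 = 0" by simp
  qed
qed

lemma minimal_sublinear:
  fixes p :: "'a::real_vector \<Rightarrow> real"
  assumes p: "sublinear p"
  obtains q where "sublinear q" "\<And>x. q x \<le> p x"
    "\<And>r. sublinear r \<Longrightarrow> (\<And>x. r x \<le> q x) \<Longrightarrow> r = q"
proof -
  define A where "A = {q. sublinear q \<and> (\<forall>x. q x \<le> p x)}"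
  \<comment> \<open>The pointwise order is reversed, so that maximal elements for \<open>P\<close>
    are minimal functionals.\<close>
  define P :: "('a \<Rightarrow> real) \<Rightarrow> ('a \<Rightarrow> real) \<Rightarrow> bool" where "P = (\<lambda>q r. \<forall>x. r x \<le> q x)"
  have "\<exists>m\<in>A. \<forall>a\<in>A. P m a \<longrightarrow> a = m"
  proof (rule predicate_Zorn)
    show "partial_order_on A (relation_of P A)"
    proof (rule partial_order_on_relation_ofI)
      fix q r s assume "P q r" "P r s"
      then show "P q s" unfolding P_def by (meson order.trans)
    next
      fix q r assume "P q r" "P r q"
      then show "q = r" unfolding P_def by (intro ext order.antisym) auto
    qed (simp add: P_def)
  next
    fix C assume C: "C \<in> Chains (relation_of P A)"
    show "\<exists>u\<in>A. \<forall>a\<in>C. P a u"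
    proof (cases "C = {}")
      case True
      then show ?thesis using p by (auto simp: A_def)
    next
      case False
      have CA: "q \<in> C \<Longrightarrow> sublinear q \<and> (\<forall>x. q x \<le> p x)" for q
        using C by (auto simp: Chains_def relation_of_def A_def)
      have ch: "q \<in> C \<Longrightarrow> r \<in> C \<Longrightarrow> (\<forall>x. q x \<le> r x) \<or> (\<forall>x. r x \<le> q x)" for q r
        using C by (auto simp: Chains_def relation_of_def P_def)
      let ?m = "\<lambda>x. INF q\<in>C. q x"
      have m: "sublinear ?m" "\<And>q x. q \<in> C \<Longrightarrow> ?m x \<le> q x"
        by (rule sublinear_INF_chain[OF False CA ch]; assumption)+
      obtain q where "q \<in> C" using False by blast
      then have "?m x \<le> p x" for x
        using order.trans[OF m(2)[of q x], of "p x"] CA[of q] by blast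
      then have "?m \<in> A" using m(1) by (simp add: A_def)
      then show ?thesis using m(2) unfolding P_def by (intro bexI[of _ ?m]) simp_all
    qed
  qed
  then obtain q where "q \<in> A" and min: "\<And>r. r \<in> A \<Longrightarrow> (\<And>x. r x \<le> q x) \<Longrightarrow> r = q"
    unfolding P_def by blast
  then have q: "sublinear q" "\<And>x. q x \<le> p x"
    by (simp_all add: A_def)
  have "r = q" if "sublinear r" "\<And>x. r x \<le> q x" for r
  proof (rule min)
    show "r \<in> A" using that(1) order.trans[OF that(2) q(2)] by (simp add: A_def)
  qed (rule that(2))
  with q show thesis using that by blast
qed

text \<open>A minimal sublinear functional is linear: each of its shifts is sublinear and lies below
  it, hence equals it, and the shift with \<open>t = 1\<close> then gives superadditivity.
  Minimising below \<open>sublinear_shift p x0\<close> instead of \<open>p\<close> secures equality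
  at \<open>x0\<close>.\<close>

lemma Hahn_Banach_sublinear:
  fixes p :: "'a::real_vector \<Rightarrow> real"
  assumes p: "sublinear p"
  obtains f where "linear f" "\<And>x. f x \<le> p x" "f x0 = p x0"
proof -
  obtain q where q: "sublinear q" and qp: "\<And>x. q x \<le> sublinear_shift p x0 x"
    and min: "\<And>r. sublinear r \<Longrightarrow> (\<And>x. r x \<le> q x) \<Longrightarrow> r = q"
    using minimal_sublinear[OF sublinear_shift[OF p, of x0]] by blast
  have shift: "sublinear_shift q y = q" for y
    using min[OF sublinear_shift[OF q] sublinear_shift_le_self[OF q]] .
  have add: "q (x + y) = q x + q y" for x y
    using sublinear_shift_le[OF q, of 1 y x] shift[of y] sublinear_add[OF q, of x y] by simp
  have neg: "q (- x) = - q x" for x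
    using add[of x "- x"] sublinear_zero[OF q] by simp
  have scale: "q (c *\<^sub>R x) = c * q x" for c x
  proof (cases "0 \<le> c")
    case False
    then show ?thesis using sublinear_scaleR[OF q, of "- c" x] neg[of "c *\<^sub>R x"] by simp
  qed (simp add: sublinear_scaleR q)
  have "linear q" by (rule linearI) (simp_all add: add scale)
  moreover have le: "q x \<le> p x" for x
    using qp[of x] sublinear_shift_le_self[OF p, of x0 x] by linarith
  \<comment> \<open>The term \<open>t = 1\<close> of the shift at \<open>- x0\<close> is
    \<open>p 0 - p x0\<close>.\<close>
  moreover have "q (- x0) \<le> - p x0"
    using qp[of "- x0"] sublinear_shift_le[OF p, of 1 x0 "- x0"] sublinear_zero[OF p] by simp
  then have "q x0 = p x0" using neg[of x0] le[of x0] by simp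
  ultimately show thesis using that by blast
qed

subsection \<open>Weak* and weak compactness of unit balls\<close>

text \<open>Banach-Alaoglu. Functionals are viewed as plain functions, where the product topology is
  the weak* topology; the ball is a Tychonoff cube cut by the closed conditions of
  linearity.\<close>

lemma compact_dual_ball:
  "compact (blinfun_apply ` cball (0 :: 'a::real_normed_vector \<Rightarrow>\<^sub>L real) 1)"
proof -
  let ?P = "PiE UNIV (\<lambda>x::'a. {- norm x .. norm x})"
  let ?L = "(\<Inter>x y. {f :: 'a \<Rightarrow> real. f (x + y) = f x + f y}) \<inter> (\<Inter>c x. {f. f (c *\<^sub>R x) = c * f x})"
  have "compactin (product_topology (\<lambda>_. euclidean) UNIV) ?P"
    by (simp add: compactin_PiE)
  then have P: "compact ?P" by (simp add: euclidean_product_topology)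
  have L: "closed ?L"
    by (intro closed_Int closed_INT ballI closed_Collect_eq continuous_on_add continuous_on_mult
        continuous_on_const continuous_on_product_coordinates)
  have "blinfun_apply ` cball (0 :: 'a \<Rightarrow>\<^sub>L real) 1 = ?P \<inter> ?L"
  proof safe
    fix f :: "'a \<Rightarrow>\<^sub>L real" and x assume "f \<in> cball 0 1"
    then have "\<bar>f x\<bar> \<le> norm x"
      using norm_blinfun[of f x] mult_right_mono[of "norm f" 1 "norm x"] by simp
    then show "f x \<in> {- norm x .. norm x}" by auto
  next
    fix f :: "'a \<Rightarrow> real"
    assume P: "f \<in> ?P" and "f \<in> (\<Inter>x y. {f. f (x + y) = f x + f y})"
      "f \<in> (\<Inter>c x. {f. f (c *\<^sub>R x) = c * f x})"
    then have lin: "linear f" by (intro linearI) auto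
    have le: "norm (f x) \<le> 1 * norm x" for x
    proof -
      have "f x \<in> {- norm x .. norm x}" using P by (auto simp: PiE_def Pi_def)
      then show ?thesis by (auto simp: abs_le_iff)
    qed
    have "bounded_linear f"
    proof (rule bounded_linear_intro[where K=1])
      show "norm (f x) \<le> norm x * 1" for x using le[of x] by simp
    qed (simp_all add: linear_add[OF lin] linear_scale[OF lin])
    then have *: "blinfun_apply (Blinfun f) = f" by (rule bounded_linear_Blinfun_apply)
    moreover have "norm (Blinfun f) \<le> 1"
      using le * by (intro norm_blinfun_bound) auto
    ultimately show "f \<in> blinfun_apply ` cball 0 1"
      by (metis image_eqI mem_cball_0)
  qed (auto simp: blinfun.add_right blinfun.scaleR_right)
  with P L show ?thesis by (simp add: compact_Int_closed)
qed

text \<open>Compactness yields a weak* cluster point, not a convergent subsequence. Since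
  \<open>{h. h x < c}\<close> is open, eventual lower bounds survive at that point; upper bounds
  follow by passing to \<open>- x\<close>.\<close>

lemma dual_sequence_cluster:
  fixes f :: "nat \<Rightarrow> 'a::real_normed_vector \<Rightarrow>\<^sub>L real"
  assumes "\<And>n. norm (f n) \<le> 1"
  obtains g :: "'a \<Rightarrow>\<^sub>L real" where "norm g \<le> 1"
    "\<And>x c. eventually (\<lambda>n. c \<le> f n x) sequentially \<Longrightarrow> c \<le> g x"
proof -
  let ?F = "filtermap (\<lambda>n. blinfun_apply (f n)) sequentially"
  have "?F \<noteq> bot" by (simp add: filtermap_bot_iff)
  moreover have "eventually (\<lambda>y. y \<in> blinfun_apply ` cball 0 1) ?F"
    using assms by (auto simp: eventually_filtermap)
  ultimately obtain g where g: "g \<in> cball 0 1" and cl: "inf (nhds (blinfun_apply g)) ?F \<noteq> bot"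
    using compact_dual_ball[where 'a='a] unfolding compact_filter by blast
  have "c \<le> g x" if ev: "eventually (\<lambda>n. c \<le> f n x) sequentially" for x c
  proof (rule ccontr)
    assume "\<not> c \<le> g x"
    moreover have "open {h :: 'a \<Rightarrow> real. h x < c}"
      by (intro open_Collect_less continuous_on_const continuous_on_product_coordinates)
    ultimately have "eventually (\<lambda>h. h x < c) (nhds (blinfun_apply g))"
      unfolding eventually_nhds by (intro exI[of _ "{h. h x < c}"]) auto
    moreover have "eventually (\<lambda>h. c \<le> h x) ?F"
      using ev by (simp add: eventually_filtermap)
    ultimately have "eventually (\<lambda>h. False) (inf (nhds (blinfun_apply g)) ?F)"
      unfolding eventually_inf by (intro exI[of _ "\<lambda>h. h x < c"] exI[of _ "\<lambda>h. c \<le> h x"]) auto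
    with cl show False by simp
  qed
  with g show thesis using that by simp
qed

section \<open>Norming functionals and reflexivity\<close>

lemma norm_attaining_functional:
  fixes x :: "'a::real_normed_vector"
  obtains f :: "'a \<Rightarrow>\<^sub>L real" where "norm f \<le> 1" "f x = norm x"
proof -
  have "sublinear (norm :: 'a \<Rightarrow> real)"
    by (rule sublinearI) (simp_all add: norm_triangle_ineq)
  then obtain f :: "'a \<Rightarrow> real" where f: "linear f" "\<And>y. f y \<le> norm y" "f x = norm x"
    using Hahn_Banach_sublinear by blast
  have le: "norm (f y) \<le> norm y" for y
    using f(2)[of y] f(2)[of "- y"] by (simp add: linear_neg[OF f(1)] abs_le_iff)
  have "bounded_linear f"
    by (rule bounded_linear_intro[where K=1])
      (use le in \<open>simp_all add: linear_add[OF f(1)] linear_scale[OF f(1)]\<close>)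
  then have "blinfun_apply (Blinfun f) = f" by (rule bounded_linear_Blinfun_apply)
  moreover from this have "norm (Blinfun f) \<le> 1"
    using le by (intro norm_blinfun_bound) auto
  ultimately show thesis using that[of "Blinfun f"] f by simp
qed

lift_definition evaluation :: "'a::real_normed_vector \<Rightarrow> ('a \<Rightarrow>\<^sub>L real) \<Rightarrow>\<^sub>L real"
  is "\<lambda>x f. blinfun_apply f x"
  by (rule blinfun.bounded_linear_left)

lemma norm_evaluation_le: "norm (evaluation x) \<le> norm x"
proof (rule norm_blinfun_bound)
  fix f :: "'a \<Rightarrow>\<^sub>L real"
  show "norm (evaluation x f) \<le> norm x * norm f"
    using norm_blinfun[of f x] by (simp add: evaluation.rep_eq mult.commute)
qed simp

text \<open>By reflexivity the evaluations at points of the ball are exactly the unit ball of the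
  bidual, to which Banach-Alaoglu applies.\<close>

lemma reflexive_ball_weakly_compact:
  assumes "reflexive_space TYPE('a::banach)"
  shows "compact ((\<lambda>x (f :: 'a \<Rightarrow>\<^sub>L real). f x) ` cball 0 1)"
proof -
  have "(\<lambda>x (f :: 'a \<Rightarrow>\<^sub>L real). f x) ` cball 0 1 = blinfun_apply ` cball 0 1"
  proof safe
    fix x :: 'a assume "x \<in> cball 0 1"
    then have "norm (evaluation x) \<le> 1" using norm_evaluation_le[of x] by simp
    moreover have "blinfun_apply (evaluation x) = (\<lambda>f. f x)" by (rule ext) (simp add: evaluation.rep_eq)
    ultimately show "(\<lambda>f :: 'a \<Rightarrow>\<^sub>L real. f x) \<in> blinfun_apply ` cball 0 1"
      by (intro image_eqI[where x = "evaluation x"]) simp_all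
  next
    fix \<phi> :: "('a \<Rightarrow>\<^sub>L real) \<Rightarrow>\<^sub>L real" assume \<phi>: "\<phi> \<in> cball 0 1"
    obtain x where x: "\<And>f. \<phi> f = blinfun_apply f x"
      using assms unfolding reflexive_space_def by blast
    \<comment> \<open>A norming functional for \<open>x\<close> shows that the representing point is
      no longer than \<open>\<phi>\<close>.\<close>
    obtain f :: "'a \<Rightarrow>\<^sub>L real" where f: "norm f \<le> 1" "f x = norm x"
      by (rule norm_attaining_functional)
    have "norm x = \<phi> f" using f x by simp
    also have "\<dots> \<le> norm \<phi> * norm f" using norm_blinfun[of \<phi> f] by simp
    also have "\<dots> \<le> 1 * 1" using f \<phi> by (intro mult_mono) auto
    finally have "x \<in> cball 0 1" by simp
    moreover have "blinfun_apply \<phi> = (\<lambda>f. f x)" using x by blast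
    ultimately show "blinfun_apply \<phi> \<in> (\<lambda>x f. blinfun_apply f x) ` cball 0 1" by blast
  qed
  then show ?thesis using compact_dual_ball by metis
qed

text \<open>The sequence is scaled into the unit ball and embedded in the bidual; a weak* cluster
  point there comes from a point of the space by reflexivity.\<close>

lemma reflexive_sequence_cluster:
  fixes s :: "nat \<Rightarrow> 'a::banach"
  assumes refl: "reflexive_space TYPE('a)" and bdd: "\<And>n. norm (s n) \<le> R"
  obtains x where "\<And>(f :: 'a \<Rightarrow>\<^sub>L real) c. eventually (\<lambda>n. c \<le> f (s n)) sequentially \<Longrightarrow> c \<le> f x"
proof -
  \<comment> \<open>The summand 1 keeps the scaling factor positive even when
    \<open>R = 0\<close>.\<close>
  define r where "r = R + 1"
  have r: "0 < r" using order.trans[OF norm_ge_zero bdd[of 0]] by (simp add: r_def)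
  have "norm (evaluation (s n /\<^sub>R r)) \<le> 1" for n
  proof -
    have "norm (s n /\<^sub>R r) \<le> 1" using bdd[of n] r by (simp add: r_def divide_simps)
    then show ?thesis by (rule order.trans[OF norm_evaluation_le])
  qed
  then obtain \<phi> :: "('a \<Rightarrow>\<^sub>L real) \<Rightarrow>\<^sub>L real"
    where \<phi>: "\<And>f c. eventually (\<lambda>n. c \<le> evaluation (s n /\<^sub>R r) f) sequentially \<Longrightarrow> c \<le> \<phi> f"
    using dual_sequence_cluster[of "\<lambda>n. evaluation (s n /\<^sub>R r)"] by blast
  obtain x where x: "\<And>f. \<phi> f = blinfun_apply f x"
    using refl unfolding reflexive_space_def by blast
  have "c \<le> f (r *\<^sub>R x)" if ev: "eventually (\<lambda>n. c \<le> f (s n)) sequentially" for f :: "'a \<Rightarrow>\<^sub>L real" and c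
  proof -
    have "eventually (\<lambda>n. c / r \<le> evaluation (s n /\<^sub>R r) f) sequentially"
      using ev r by (simp add: evaluation.rep_eq blinfun.scaleR_right field_simps)
    from \<phi>[OF this] show ?thesis
      using r by (simp add: x blinfun.scaleR_right field_simps)
  qed
  then show thesis using that by blast
qed

text \<open>If \<open>g\<close> stayed below \<open>c\<close> on the unit ball, so would its
  absolute value, since the ball is symmetric.\<close>

lemma blinfun_norm_approx:
  fixes g :: "'a::real_normed_vector \<Rightarrow>\<^sub>L real"
  assumes "c < norm g"
  obtains x where "norm x \<le> 1" "c < g x"
proof (rule ccontr)
  assume "\<not> thesis"
  with that have le: "g x \<le> c" if "norm x \<le> 1" for x
    using \<open>norm x \<le> 1\<close> by (meson not_le)
  have "0 \<le> c" using le[of 0] by simp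
  moreover have "norm (g x) \<le> c * norm x" for x
  proof (cases "x = 0")
    case False
    have "g (x /\<^sub>R norm x) \<le> c" "g (- (x /\<^sub>R norm x)) \<le> c"
      using False by (intro le; simp)+
    then have "\<bar>g x\<bar> / norm x \<le> c"
      by (auto simp: blinfun.scaleR_right blinfun.minus_right abs_if divide_inverse mult.commute)
    then show ?thesis using False by (simp add: field_simps)
  qed simp
  ultimately have "norm g \<le> c" by (rule norm_blinfun_bound)
  with assms show False by simp
qed

subsection \<open>Positive functionals on a Banach lattice\<close>

definition positive_functional :: "('a::{real_normed_vector,order} \<Rightarrow>\<^sub>L real) \<Rightarrow> bool" where
  "positive_functional f \<longleftrightarrow> (\<forall>x\<ge>0. 0 \<le> f x)"

text \<open>The sort alone does not relate the order to the linear structure or the norm; the locale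
  supplies these axioms.\<close>

locale banach_lattice_type =
  fixes T :: "'a::{banach,lattice} itself"
  assumes banach_lattice: "banach_lattice T"
begin

lemma translate_mono: "(x::'a) \<le> y \<Longrightarrow> x + z \<le> y + z"
  using banach_lattice by (simp add: banach_lattice_def)

text \<open>Gives access to the theory of lattice-ordered abelian groups under the prefix
  \<open>lat\<close>.\<close>

sublocale lat: lattice_ab_group_add_abs lat_abs "(+)" "0::'a" "(-)" uminus "(\<le>)" "(<)" inf sup
proof unfold_locales
  show "z + x \<le> z + y" if "x \<le> y" for x y z :: 'a
    using translate_mono[OF that, of z] by (simp add: add.commute)
qed (simp add: lat_abs_def)

lemma scale_mono: "(x::'a) \<le> y \<Longrightarrow> 0 \<le> c \<Longrightarrow> c *\<^sub>R x \<le> c *\<^sub>R y"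
  using banach_lattice by (simp add: banach_lattice_def)

lemma scale_nonneg: "0 \<le> (x::'a) \<Longrightarrow> 0 \<le> c \<Longrightarrow> 0 \<le> c *\<^sub>R x"
  using scale_mono[of 0 x c] by simp

lemma scale_left_mono: "0 \<le> (x::'a) \<Longrightarrow> c \<le> d \<Longrightarrow> c *\<^sub>R x \<le> d *\<^sub>R x"
  using scale_nonneg[of x "d - c"] by (simp add: scaleR_diff_left)

lemma scale_inf: "0 < c \<Longrightarrow> c *\<^sub>R inf (x::'a) y = inf (c *\<^sub>R x) (c *\<^sub>R y)"
proof (rule order.antisym)
  assume c: "0 < c"
  show "c *\<^sub>R inf x y \<le> inf (c *\<^sub>R x) (c *\<^sub>R y)"
    using c by (intro inf_greatest scale_mono) auto
  have "(1/c) *\<^sub>R inf (c *\<^sub>R x) (c *\<^sub>R y) \<le> inf x y"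
    using c scale_mono[OF inf.cobounded1, of "1/c" "c *\<^sub>R x" "c *\<^sub>R y"]
      scale_mono[OF inf.cobounded2, of "1/c" "c *\<^sub>R x" "c *\<^sub>R y"]
    by (intro inf_greatest) simp_all
  then show "inf (c *\<^sub>R x) (c *\<^sub>R y) \<le> c *\<^sub>R inf x y"
    using c scale_mono[of "(1/c) *\<^sub>R inf (c *\<^sub>R x) (c *\<^sub>R y)" "inf x y" c] by simp
qed

lemma lat_abs_nonneg: "0 \<le> lat_abs (x::'a)"
  by (rule lat.abs_ge_zero)

lemma lat_abs_of_nonneg: "0 \<le> (x::'a) \<Longrightarrow> lat_abs x = x"
  by (rule lat.abs_of_nonneg)

lemma norm_mono_lat_abs: "lat_abs (x::'a) \<le> lat_abs y \<Longrightarrow> norm x \<le> norm y"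
  using banach_lattice by (simp add: banach_lattice_def)

lemma norm_mono: "0 \<le> (x::'a) \<Longrightarrow> x \<le> y \<Longrightarrow> norm x \<le> norm y"
  by (rule norm_mono_lat_abs) (metis lat_abs_of_nonneg order.trans)

lemma norm_sup_0_le: "norm (sup (x::'a) 0) \<le> norm x"
proof (rule norm_mono_lat_abs)
  have "sup x 0 \<le> lat_abs x"
    using lat_abs_nonneg[of x] by (simp add: lat_abs_def)
  then show "lat_abs (sup x 0) \<le> lat_abs x"
    by (simp add: lat_abs_of_nonneg)
qed

lemma norm_sup_0_eq_0_iff: "norm (sup (x::'a) 0) = 0 \<longleftrightarrow> x \<le> 0"
  by (metis norm_eq_zero sup.absorb_iff2)

text \<open>The norm of the positive part is the right dominating function for Hahn-Banach: it is at
  most the norm and vanishes on negative elements, so linear functionals below it are positive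
  contractions.\<close>

lemma sublinear_norm_sup_0: "sublinear (\<lambda>x::'a. norm (sup x 0))"
proof (rule sublinearI)
  fix x y :: 'a
  have "x + y \<le> sup x 0 + sup y 0" by (intro lat.add_mono) auto
  moreover have "0 \<le> sup x 0 + sup y 0" by (intro lat.add_nonneg_nonneg) auto
  ultimately have "norm (sup (x + y) 0) \<le> norm (sup x 0 + sup y 0)"
    by (intro norm_mono) auto
  also have "\<dots> \<le> norm (sup x 0) + norm (sup y 0)" by (rule norm_triangle_ineq)
  finally show "norm (sup (x + y) 0) \<le> norm (sup x 0) + norm (sup y 0)" .
next
  fix c :: real and x :: 'a assume c: "0 < c"
  have "c *\<^sub>R x \<le> c *\<^sub>R sup x 0" "0 \<le> c *\<^sub>R sup x 0"
    using c by (intro scale_mono scale_nonneg; simp)+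
  then have "norm (sup (c *\<^sub>R x) 0) \<le> norm (c *\<^sub>R sup x 0)"
    by (intro norm_mono) auto
  then show "norm (sup (c *\<^sub>R x) 0) \<le> c * norm (sup x 0)" using c by simp
qed simp

lemma positive_norming_functional:
  obtains f :: "'a \<Rightarrow>\<^sub>L real"
  where "norm f \<le> 1" "positive_functional f" "f x = norm (sup x 0)"
proof -
  obtain f :: "'a \<Rightarrow> real" where f: "linear f" "\<And>y. f y \<le> norm (sup y 0)" "f x = norm (sup x 0)"
    using Hahn_Banach_sublinear[OF sublinear_norm_sup_0] by blast
  have le: "norm (f y) \<le> norm y" for y
    using f(2)[of y] f(2)[of "- y"] norm_sup_0_le[of y] norm_sup_0_le[of "- y"]
    by (simp add: linear_neg[OF f(1)] abs_le_iff)
  have "bounded_linear f"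
    by (rule bounded_linear_intro[where K=1])
      (use le in \<open>simp_all add: linear_add[OF f(1)] linear_scale[OF f(1)]\<close>)
  then have b: "blinfun_apply (Blinfun f) = f" by (rule bounded_linear_Blinfun_apply)
  moreover from this have "norm (Blinfun f) \<le> 1"
    using le by (intro norm_blinfun_bound) auto
  moreover have "positive_functional (Blinfun f)"
    unfolding positive_functional_def b
  proof (intro allI impI)
    fix y :: 'a assume "0 \<le> y"
    then have "norm (sup (- y) 0) = 0" unfolding norm_sup_0_eq_0_iff by simp
    then show "0 \<le> f y" using f(2)[of "- y"] by (simp add: linear_neg[OF f(1)])
  qed
  ultimately show thesis using that[of "Blinfun f"] f by simp
qed

lemma positive_functional_mono:
  fixes f :: "'a \<Rightarrow>\<^sub>L real"
  assumes "positive_functional f" "x \<le> y"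
  shows "f x \<le> f y"
proof -
  have "0 \<le> y - x" using assms(2) by simp
  then have "0 \<le> f (y - x)" using assms(1) unfolding positive_functional_def by blast
  then show ?thesis by (simp add: blinfun.diff_right)
qed

text \<open>A positive functional norming the positive part of \<open>x - y\<close> shows that this
  part is zero.\<close>

lemma le_if_positive_functionals:
  fixes x y :: 'a
  assumes "\<And>f :: 'a \<Rightarrow>\<^sub>L real. positive_functional f \<Longrightarrow> f x \<le> f y"
  shows "x \<le> y"
proof -
  obtain f :: "'a \<Rightarrow>\<^sub>L real" where f: "positive_functional f" "f (x - y) = norm (sup (x - y) 0)"
    by (rule positive_norming_functional)
  have "norm (sup (x - y) 0) = 0"
    using assms[OF f(1)] f(2) norm_ge_zero[of "sup (x - y) 0"]
    unfolding blinfun.diff_right by linarith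
  then have "x - y \<le> 0" unfolding norm_sup_0_eq_0_iff .
  then show ?thesis by simp
qed

subsection \<open>Order faces\<close>

text \<open>Evaluation turns the weak topology into pointwise convergence, so the condition on
  \<open>C\<close> says that \<open>F\<close> is weakly closed in the ball. The last condition uses
  \<open>\<le>\<close>, so that a one-point face is an order extreme point.\<close>

definition order_face :: "'a set \<Rightarrow> bool" where
  "order_face F \<longleftrightarrow> F \<noteq> {} \<and>
     (\<exists>C. closed C \<and> F = {x \<in> cball 0 1. (\<lambda>f :: 'a \<Rightarrow>\<^sub>L real. f x) \<in> C}) \<and>
     (\<forall>a\<in>F. \<forall>x0\<in>cball 0 1. \<forall>x1\<in>cball 0 1. \<forall>t. 0 < t \<and> t < 1 \<and> a \<le> (1 - t) *\<^sub>R x0 + t *\<^sub>R x1 \<longrightarrow>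
        x0 \<in> F \<and> x1 \<in> F)"

lemma order_faceD:
  assumes "order_face F" "a \<in> F" "norm x0 \<le> 1" "norm x1 \<le> 1" "0 < t" "t < 1"
    "a \<le> (1 - t) *\<^sub>R x0 + t *\<^sub>R x1"
  shows "x0 \<in> F" "x1 \<in> F"
proof -
  have "x0 \<in> F \<and> x1 \<in> F"
    using assms(1) unfolding order_face_def
    by (elim conjE ballE[of _ _ a] ballE[of _ _ x0] ballE[of _ _ x1] allE[of _ t])
      (use assms(2-) in simp_all)
  then show "x0 \<in> F" "x1 \<in> F" by blast+
qed

lemma order_face_nonempty: "order_face F \<Longrightarrow> F \<noteq> {}"
  unfolding order_face_def by (rule conjunct1)

lemma order_face_closedE:
  assumes "order_face F"
  obtains C where "closed C" "F = {x \<in> cball 0 1. (\<lambda>f :: 'a \<Rightarrow>\<^sub>L real. f x) \<in> C}"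
  using assms unfolding order_face_def by blast

lemma order_face_subset: "order_face F \<Longrightarrow> F \<subseteq> cball 0 1"
  by (auto elim: order_face_closedE)

lemma order_face_cball: "order_face (cball 0 1)"
  unfolding order_face_def by (intro conjI exI[of _ UNIV]) auto

lemma order_face_weakly_compact:
  assumes "reflexive_space TYPE('a)" "order_face F"
  shows "compact ((\<lambda>x (f :: 'a \<Rightarrow>\<^sub>L real). f x) ` F)"
proof -
  obtain C where C: "closed C" "F = {x \<in> cball 0 1. (\<lambda>f :: 'a \<Rightarrow>\<^sub>L real. f x) \<in> C}"
    using assms(2) by (rule order_face_closedE)
  have "(\<lambda>x (f :: 'a \<Rightarrow>\<^sub>L real). f x) ` F = ((\<lambda>x (f :: 'a \<Rightarrow>\<^sub>L real). f x) ` cball 0 1) \<inter> C"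
    unfolding C(2) by blast
  then show ?thesis
    using compact_Int_closed[OF reflexive_ball_weakly_compact[OF assms(1)] C(1)] by simp
qed

text \<open>The maximum \<open>g m\<close> is attained by weak compactness. If a maximiser lies
  below a convex combination, positivity of \<open>g\<close> makes the average of the two values at
  least \<open>g m\<close>, while neither value exceeds it.\<close>

lemma order_face_maximizers:
  fixes g :: "'a \<Rightarrow>\<^sub>L real"
  assumes refl: "reflexive_space TYPE('a)" and F: "order_face F" and g: "positive_functional g"
  shows "order_face {x \<in> F. \<forall>y\<in>F. g y \<le> g x}" (is "order_face ?M")
proof -
  let ?ev = "\<lambda>x (f :: 'a \<Rightarrow>\<^sub>L real). f x"
  obtain C where C: "closed C" "F = {x \<in> cball 0 1. ?ev x \<in> C}"
    using F by (rule order_face_closedE)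
  have ne: "?ev ` F \<noteq> {}" using order_face_nonempty[OF F] by simp
  have cont: "continuous_on (?ev ` F) (\<lambda>y. y g)"
    by (rule continuous_on_subset[OF continuous_on_product_coordinates]) simp
  obtain m where m: "m \<in> F" "\<And>y. y \<in> F \<Longrightarrow> g y \<le> g m"
    using continuous_attains_sup[OF order_face_weakly_compact[OF refl F] ne cont] by auto
  have M: "x \<in> ?M \<longleftrightarrow> x \<in> F \<and> g m \<le> g x" for x
  proof
    assume "x \<in> F \<and> g m \<le> g x"
    then show "x \<in> ?M" using order.trans[OF m(2)] by simp
  qed (use m(1) in simp)
  show ?thesis
    unfolding order_face_def
  proof (intro conjI)
    show "?M \<noteq> {}" using m by blast
    have "closed {y :: ('a \<Rightarrow>\<^sub>L real) \<Rightarrow> real. g m \<le> y g}"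
      by (intro closed_Collect_le continuous_on_const continuous_on_product_coordinates)
    then have "closed (C \<inter> {y. g m \<le> y g})" using C(1) by (rule closed_Int[rotated])
    moreover have "?M = {x \<in> cball 0 1. ?ev x \<in> C \<inter> {y. g m \<le> y g}}"
      using M C(2) by blast
    ultimately show "\<exists>C. closed C \<and> ?M = {x \<in> cball 0 1. ?ev x \<in> C}" by blast
    show "\<forall>a\<in>?M. \<forall>x0\<in>cball 0 1. \<forall>x1\<in>cball 0 1. \<forall>t. 0 < t \<and> t < 1 \<and>
        a \<le> (1 - t) *\<^sub>R x0 + t *\<^sub>R x1 \<longrightarrow> x0 \<in> ?M \<and> x1 \<in> ?M"
    proof (intro ballI allI impI)
      fix a x0 x1 and t :: real
      assume a: "a \<in> ?M" and x: "x0 \<in> cball 0 1" "x1 \<in> cball 0 1"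
        and t: "0 < t \<and> t < 1 \<and> a \<le> (1 - t) *\<^sub>R x0 + t *\<^sub>R x1"
      have "a \<in> F" using a by simp
      then have xF: "x0 \<in> F" "x1 \<in> F"
        using order_faceD[OF F, of a x0 x1 t] x t by auto
      have "g m \<le> g a" using a M by blast
      also have "\<dots> \<le> g ((1 - t) *\<^sub>R x0 + t *\<^sub>R x1)"
        using t by (intro positive_functional_mono[OF g]) blast
      also have "\<dots> = (1 - t) * g x0 + t * g x1"
        by (simp add: blinfun.add_right blinfun.scaleR_right)
      finally have le: "g m \<le> (1 - t) * g x0 + t * g x1" .
      have le0: "(1 - t) * g x0 \<le> (1 - t) * g m" and le1: "t * g x1 \<le> t * g m"
        using t m(2)[OF xF(1)] m(2)[OF xF(2)] by (auto intro: mult_left_mono)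
      have eq: "(1 - t) * g m + t * g m = g m" by (simp add: algebra_simps)
      have "(1 - t) * g m \<le> (1 - t) * g x0" "t * g m \<le> t * g x1"
        using le le0 le1 eq by linarith+
      then have "g m \<le> g x0" "g m \<le> g x1" using t by auto
      then show "x0 \<in> ?M \<and> x1 \<in> ?M" using M xF by blast
    qed
  qed
qed

text \<open>Only nonemptiness is at stake, and it follows from the finite intersection property in
  the weakly compact ball.\<close>

lemma order_face_Inter_chain:
  assumes refl: "reflexive_space TYPE('a)" and ne: "\<F> \<noteq> {}"
    and F: "\<And>F. F \<in> \<F> \<Longrightarrow> order_face F"
    and chain: "\<And>F G. F \<in> \<F> \<Longrightarrow> G \<in> \<F> \<Longrightarrow> F \<subseteq> G \<or> G \<subseteq> F"
  shows "order_face (\<Inter>\<F>)"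
proof -
  let ?ev = "\<lambda>x (f :: 'a \<Rightarrow>\<^sub>L real). f x"
  have "\<forall>F\<in>\<F>. \<exists>C. closed C \<and> F = {x \<in> cball 0 1. ?ev x \<in> C}"
    using F unfolding order_face_def by blast
  then obtain C where C: "\<And>F. F \<in> \<F> \<Longrightarrow> closed (C F)"
    "\<And>F. F \<in> \<F> \<Longrightarrow> F = {x \<in> cball 0 1. ?ev x \<in> C F}"
    by metis
  obtain F0 where F0: "F0 \<in> \<F>" using ne by blast
  have "?ev ` cball 0 1 \<inter> (\<Inter>F\<in>\<F>. C F) \<noteq> {}"
  proof (rule compact_imp_fip_image[OF reflexive_ball_weakly_compact[OF refl] C(1)])
    fix I assume I: "finite I" "I \<subseteq> \<F>"
    \<comment> \<open>A finite nonempty subfamily of a chain has a least member, and any point of it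
      lies in all the others.\<close>
    have "\<exists>F\<in>\<F>. \<forall>G\<in>I. F \<subseteq> G"
    proof (cases "I = {}")
      case False
      then obtain F where F: "F \<in> I" "\<And>G. G \<in> I \<Longrightarrow> G \<subseteq> F \<Longrightarrow> F = G"
        using finite_has_minimal[OF I(1)] by blast
      moreover have "F \<subseteq> G" if "G \<in> I" for G
        using F(2)[OF that] chain[of F G] F(1) that I(2) by blast
      ultimately show ?thesis using I(2) by blast
    qed (use F0 in blast)
    then obtain F1 where F1: "F1 \<in> \<F>" "\<And>G. G \<in> I \<Longrightarrow> F1 \<subseteq> G" by blast
    obtain x where x: "x \<in> F1" using order_face_nonempty[OF F[OF F1(1)]] by blast
    have "?ev x \<in> C G" if "G \<in> I" for G
      using C(2)[of G] F1(2)[OF that] x I(2) that by blast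
    moreover have "x \<in> cball 0 1" using x order_face_subset[OF F[OF F1(1)]] by blast
    ultimately show "?ev ` cball 0 1 \<inter> (\<Inter>F\<in>I. C F) \<noteq> {}" by blast
  qed
  then obtain x where x: "x \<in> cball 0 1" "?ev x \<in> (\<Inter>F\<in>\<F>. C F)" by blast
  have Int: "\<Inter>\<F> = {x \<in> cball 0 1. ?ev x \<in> (\<Inter>F\<in>\<F>. C F)}"
    using C(2) F0 by blast
  show ?thesis
    unfolding order_face_def
  proof (intro conjI)
    have "x \<in> \<Inter>\<F>" unfolding Int using x by blast
    then show "\<Inter>\<F> \<noteq> {}" by blast
    show "\<exists>C. closed C \<and> \<Inter>\<F> = {x \<in> cball 0 1. ?ev x \<in> C}"
      using Int C(1) by (intro exI[of _ "\<Inter>F\<in>\<F>. C F"]) blast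
    show "\<forall>a\<in>\<Inter>\<F>. \<forall>x0\<in>cball 0 1. \<forall>x1\<in>cball 0 1. \<forall>t. 0 < t \<and> t < 1 \<and>
        a \<le> (1 - t) *\<^sub>R x0 + t *\<^sub>R x1 \<longrightarrow> x0 \<in> \<Inter>\<F> \<and> x1 \<in> \<Inter>\<F>"
      using order_faceD[OF F] by (meson Inter_iff mem_cball_0)
  qed
qed

lemma order_face_minimal:
  assumes refl: "reflexive_space TYPE('a)" and F0: "order_face F0"
  obtains F where "order_face F" "F \<subseteq> F0" "\<And>G. order_face G \<Longrightarrow> G \<subseteq> F \<Longrightarrow> G = F"
proof -
  \<comment> \<open>Taking complements turns minimal faces into maximal sets and intersections of
    chains into unions, as Zorn's lemma for inclusion requires.\<close>
  define \<A> where "\<A> = uminus ` {F. order_face F \<and> F \<subseteq> F0}"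
  have "\<exists>M\<in>\<A>. \<forall>X\<in>\<A>. M \<subseteq> X \<longrightarrow> X = M"
  proof (rule subset_Zorn_nonempty)
    show "\<A> \<noteq> {}" using F0 by (auto simp: \<A>_def)
  next
    fix \<C> assume ne: "\<C> \<noteq> {}" and ch: "subset.chain \<A> \<C>"
    have sub: "\<C> \<subseteq> \<A>" and cmp: "\<And>X Y. X \<in> \<C> \<Longrightarrow> Y \<in> \<C> \<Longrightarrow> X \<subseteq> Y \<or> Y \<subseteq> X"
      using ch unfolding subset_chain_def by blast+
    have "order_face (\<Inter> (uminus ` \<C>))"
    proof (rule order_face_Inter_chain[OF refl])
      show "uminus ` \<C> \<noteq> {}" using ne by simp
      show "order_face F" if "F \<in> uminus ` \<C>" for F
        using that sub unfolding \<A>_def by auto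
      show "F \<subseteq> G \<or> G \<subseteq> F" if "F \<in> uminus ` \<C>" "G \<in> uminus ` \<C>" for F G
    proof -
      obtain X Y where "X \<in> \<C>" "Y \<in> \<C>" "F = - X" "G = - Y" using \<open>F \<in> uminus ` \<C>\<close> \<open>G \<in> uminus ` \<C>\<close> by blast
      then show ?thesis using cmp[of X Y] by blast
    qed
    qed
    moreover have "\<Inter> (uminus ` \<C>) \<subseteq> F0" using ne sub unfolding \<A>_def by blast
    moreover have "\<Union>\<C> = - \<Inter> (uminus ` \<C>)" by auto
    ultimately show "\<Union>\<C> \<in> \<A>" unfolding \<A>_def by blast
  qed
  then obtain M where M: "M \<in> \<A>" and max: "\<And>X. X \<in> \<A> \<Longrightarrow> M \<subseteq> X \<Longrightarrow> X = M"
    by blast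
  obtain F where F: "order_face F" "F \<subseteq> F0" and MF: "M = - F"
    using M unfolding \<A>_def by blast
  have "G = F" if "order_face G" "G \<subseteq> F" for G
  proof -
    have "- G \<in> \<A>" using that F(2) unfolding \<A>_def by blast
    then have "- G = M" using that(2) MF by (intro max) auto
    then show ?thesis using MF by simp
  qed
  with F show thesis using that by blast
qed

lemma positive_functional_attains_at_order_extreme_point:
  fixes g :: "'a \<Rightarrow>\<^sub>L real"
  assumes refl: "reflexive_space TYPE('a)" and g: "positive_functional g"
  obtains a where "order_extreme_point (cball 0 1) a" "\<And>x. norm x \<le> 1 \<Longrightarrow> g x \<le> g a"
proof -
  \<comment> \<open>Minimising inside the face of maximisers of \<open>g\<close> keeps the
    maximality of \<open>g\<close> at the point finally found.\<close>
  obtain F where F: "order_face F" "F \<subseteq> {x \<in> cball 0 1. \<forall>y\<in>cball 0 1. g y \<le> g x}"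
    and min: "\<And>G. order_face G \<Longrightarrow> G \<subseteq> F \<Longrightarrow> G = F"
    using order_face_minimal[OF refl order_face_maximizers[OF refl order_face_cball g]] by blast
  obtain a where a: "a \<in> F" using order_face_nonempty[OF F(1)] by blast
  have eq: "x = y" if xy: "x \<in> F" "y \<in> F" for x y
  proof -
    have "h x = h y" if h: "positive_functional h" for h :: "'a \<Rightarrow>\<^sub>L real"
    proof -
      \<comment> \<open>The maximisers of \<open>h\<close> in \<open>F\<close> form a smaller face,
        hence all of \<open>F\<close>; thus \<open>h\<close> is constant on
        \<open>F\<close>.\<close>
      have "{x \<in> F. \<forall>y\<in>F. h y \<le> h x} = F"
        by (intro min order_face_maximizers[OF refl F(1) h]) blast
      then show ?thesis using xy by (intro order.antisym) blast+
    qed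
    then show "x = y" by (intro order.antisym le_if_positive_functionals) simp_all
  qed
  have "order_extreme_point (cball 0 1) a"
    unfolding order_extreme_point_def
  proof (intro conjI ballI allI impI)
    show "a \<in> cball 0 1" using a order_face_subset[OF F(1)] by blast
    fix x0 x1 :: 'a and t :: real
    assume "x0 \<in> cball 0 1" "x1 \<in> cball 0 1" "0 < t \<and> t < 1 \<and> a \<le> (1 - t) *\<^sub>R x0 + t *\<^sub>R x1"
    then have "x0 \<in> F" "x1 \<in> F" using order_faceD[OF F(1) a, of x0 x1 t] by simp_all
    then show "x0 = a" "x1 = a" using eq a by blast+
  qed
  moreover have "g x \<le> g a" if "norm x \<le> 1" for x
    using F(2) a that by auto
  ultimately show thesis using that by blast
qed

subsection \<open>Monotone sequences in reflexive Banach lattices\<close>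

text \<open>A Dini argument: the weak cluster point of an increasing sequence is its weak limit, and weak* compactness of the
  dual ball provides one positive functional that detects all the remainders at once.\<close>

lemma no_separated_increasing_sequence:
  fixes s u :: "nat \<Rightarrow> 'a"
  assumes refl: "reflexive_space TYPE('a)" and bdd: "\<And>n. norm (s n) \<le> R"
    and u: "\<And>n. 0 \<le> u n" "\<And>n. 1 \<le> norm (u n)" and s: "\<And>n. s (Suc n) = s n + u n"
  shows False
proof -
  have incr: "s m \<le> s n" if "m \<le> n" for m n
    using that
  proof (induction rule: dec_induct)
    case (step n)
    have "s n \<le> s (Suc n)" using u(1)[of n] by (simp add: s)
    with step.IH show ?case by (rule order.trans)
  qed simp
  obtain x where x: "\<And>(f :: 'a \<Rightarrow>\<^sub>L real) c. eventually (\<lambda>n. c \<le> f (s n)) sequentially \<Longrightarrow> c \<le> f x"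
    by (rule reflexive_sequence_cluster[of s R, OF refl bdd]) (rule that)
  have sx: "s n \<le> x" for n
  proof (rule le_if_positive_functionals)
    fix f :: "'a \<Rightarrow>\<^sub>L real" assume "positive_functional f"
    then show "f (s n) \<le> f x"
      using incr by (intro x eventually_sequentiallyI[of n] positive_functional_mono)
  qed
  \<comment> \<open>The remainder dominates the next increment, so its norm stays at least
    1.\<close>
  have rem: "u n \<le> x - s n" for n
    using sx[of "Suc n"] by (simp add: s lat.le_diff_eq add.commute)
  have "\<exists>f :: 'a \<Rightarrow>\<^sub>L real. norm f \<le> 1 \<and> positive_functional f \<and> 1 \<le> f (x - s n)" for n
  proof -
    obtain f :: "'a \<Rightarrow>\<^sub>L real" where f: "norm f \<le> 1" "positive_functional f" "f (u n) = norm (sup (u n) 0)"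
      by (rule positive_norming_functional)
    have "1 \<le> f (u n)" using u[of n] f(3) by (simp add: sup_absorb1)
    also have "\<dots> \<le> f (x - s n)" by (rule positive_functional_mono[OF f(2) rem])
    finally show ?thesis using f by blast
  qed
  then obtain f :: "nat \<Rightarrow> 'a \<Rightarrow>\<^sub>L real" where f: "\<And>n. norm (f n) \<le> 1" "\<And>n. positive_functional (f n)"
    "\<And>n. 1 \<le> f n (x - s n)"
    by metis
  obtain g :: "'a \<Rightarrow>\<^sub>L real" where g: "\<And>x c. eventually (\<lambda>n. c \<le> f n x) sequentially \<Longrightarrow> c \<le> g x"
    by (rule dual_sequence_cluster[of f, OF f(1)]) (rule that)
  \<comment> \<open>For \<open>n \<ge> k\<close> the remainder at \<open>k\<close> dominates the one
    at \<open>n\<close>, so a single cluster functional \<open>g\<close> detects every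
    remainder.\<close>
  have "1 \<le> g (x - s k)" for k
  proof (rule g, rule eventually_sequentiallyI)
    fix n assume "k \<le> n"
    then have "x - s n \<le> x - s k" using incr by (intro lat.diff_left_mono) 
    then show "1 \<le> f n (x - s k)"
      by (rule order.trans[OF f(3) positive_functional_mono[OF f(2)]])
  qed
  \<comment> \<open>This lower bound for \<open>- g\<close> along the sequence passes to the weak
    cluster point \<open>x\<close>, which yields \<open>1 \<le> 0\<close>.\<close>
  then have "1 - g x \<le> (- g) (s k)" for k
    by (simp add: blinfun.diff_right blinfun.minus_left algebra_simps)
  then have "1 - g x \<le> (- g) x" by (intro x) simp
  then show False by (simp add: blinfun.minus_left)
qed

subsection \<open>Disjoint systems and atoms\<close>

text \<open>The positive part of \<open>x - y\<close> is dominated by every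
  \<open>e *\<^sub>R a\<close>, so its norm is at most \<open>e * norm a\<close> for all
  \<open>e > 0\<close>.\<close>

lemma le_archimedean:
  fixes x y a :: 'a
  assumes a: "0 \<le> a" and le: "\<And>e. 0 < e \<Longrightarrow> x \<le> y + e *\<^sub>R a"
  shows "x \<le> y"
proof (rule ccontr)
  assume "\<not> x \<le> y"
  then have "\<not> x - y \<le> 0" by simp
  then have N: "0 < norm (sup (x - y) 0)" unfolding norm_sup_0_eq_0_iff[symmetric] by (simp only: zero_less_norm_iff norm_eq_zero not_False_eq_True)
  \<comment> \<open>The denominator \<open>norm a + 1\<close> makes \<open>e * norm a\<close>
    strictly smaller than the norm in the numerator, also for \<open>a = 0\<close>.\<close>
  define e where "e = norm (sup (x - y) 0) / (norm a + 1)"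
  have na: "0 < norm a + 1" using norm_ge_zero[of a] by linarith
  then have e: "0 < e" using N by (simp add: e_def)
  have "x - y \<le> e *\<^sub>R a" using le[OF e] by (simp add: lat.diff_le_eq add.commute)
  moreover have "0 \<le> e *\<^sub>R a" using a e by (simp add: scale_nonneg)
  ultimately have "norm (sup (x - y) 0) \<le> norm (e *\<^sub>R a)" by (intro norm_mono) auto
  also have "\<dots> = e * norm a" using e by simp
  also have "\<dots> < e * (norm a + 1)" using e by simp
  also have "\<dots> = norm (sup (x - y) 0)" using na by (simp add: e_def)
  finally show False by simp
qed

text \<open>Monotonicity of the norm bounds the admissible multipliers by
  \<open>norm x / norm a\<close>, and the Archimedean property shows that their supremum is
  admissible.\<close>

lemma maximal_multiple:
  fixes a x :: 'a
  assumes a: "0 < a" and x: "0 \<le> x"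
  obtains c where "0 \<le> c" "c *\<^sub>R a \<le> x" "\<And>d. d *\<^sub>R a \<le> x \<Longrightarrow> d \<le> c"
proof -
  define S where "S = {c. 0 \<le> c \<and> c *\<^sub>R a \<le> x}"
  have a0: "0 \<le> a" "0 < norm a" using a by auto
  have S0: "0 \<in> S" using x by (simp add: S_def)
  have "c \<le> norm x / norm a" if "c \<in> S" for c
  proof -
    have "norm (c *\<^sub>R a) \<le> norm x"
      using that a0 by (intro norm_mono scale_nonneg) (auto simp: S_def)
    then show ?thesis using that a0 by (simp add: S_def field_simps)
  qed
  then have bdd: "bdd_above S" by (rule bdd_aboveI)
  have le: "c \<le> Sup S" if "c \<in> S" for c by (rule cSup_upper[OF that bdd])
  have "Sup S *\<^sub>R a \<le> x"
  proof (rule le_archimedean[OF a0(1)])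
    fix e :: real assume "0 < e"
    then have "Sup S - e < Sup S" by simp
    then obtain c where c: "c \<in> S" "Sup S - e < c"
      using less_cSupE[of "Sup S - e" S] S0 by blast
    have "Sup S *\<^sub>R a \<le> (c + e) *\<^sub>R a" using c(2) by (intro scale_left_mono a0) simp
    also have "\<dots> = c *\<^sub>R a + e *\<^sub>R a" by (rule scaleR_left_distrib)
    also have "\<dots> \<le> x + e *\<^sub>R a" using c(1) by (intro translate_mono) (simp add: S_def)
    finally show "Sup S *\<^sub>R a \<le> x + e *\<^sub>R a" .
  qed
  moreover have "d \<le> Sup S" if "d *\<^sub>R a \<le> x" for d
  proof (cases "0 \<le> d")
    case True
    then show ?thesis using that by (intro le) (simp add: S_def)
  next
    case False
    then show ?thesis using le[OF S0] by simp
  qed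
  ultimately show thesis using that le[OF S0] by blast
qed

section \<open>Calculus of disjoint positive elements\<close>

lemma inf_positive_negative_part: "inf (sup x 0) (sup (- x) 0) = (0::'a)"
proof -
  have "sup x 0 = x + sup (- x) 0"
    by (simp add: lat.add_sup_distrib_left sup_commute)
  then have "inf (sup x 0) (sup (- x) 0) = inf x 0 + sup (- x) 0"
    using lat.add_inf_distrib_right[of x 0 "sup (- x) 0"] by simp
  moreover have "sup (- x) 0 = - inf x 0"
    using lat.neg_inf_eq_sup[of x 0] by (simp only: minus_zero)
  ultimately show ?thesis by (metis right_minus)
qed

lemma disjoint_mono:
  fixes a b :: 'a
  assumes "inf a b = 0" "0 \<le> a'" "a' \<le> a" "0 \<le> b'" "b' \<le> b"
  shows "inf a' b' = 0"
proof (rule order.antisym)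
  show "inf a' b' \<le> 0" using inf_mono[OF assms(3,5)] assms(1) by simp
qed (use assms in simp)

text \<open>The infimum lies below \<open>a\<close> and below \<open>inf a b + c = c\<close>, hence
  below \<open>inf a c = 0\<close>.\<close>

lemma disjoint_add:
  fixes a b c :: 'a
  assumes "0 \<le> a" "0 \<le> b" "0 \<le> c" "inf a b = 0" "inf a c = 0"
  shows "inf a (b + c) = 0"
proof (rule order.antisym)
  let ?z = "inf a (b + c)"
  have "?z \<le> inf a b + c"
    unfolding lat.add_inf_distrib_right
    using assms lat.add_increasing2[of c a a] by (intro inf_greatest) (auto intro: le_infI1)
  then show "?z \<le> 0" using assms(4,5) by (metis add_0 inf.bounded_iff inf.cobounded1)
qed (use assms lat.add_nonneg_nonneg in simp)

lemma disjoint_scaleR: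
  fixes a b :: 'a
  assumes "0 \<le> a" "0 \<le> b" "0 \<le> c" "inf a b = 0"
  shows "inf a (c *\<^sub>R b) = 0"
proof -
  \<comment> \<open>Scaling both elements by one \<open>k\<close> above 1 and \<open>c\<close>
    preserves disjointness and dominates the pair in question.\<close>
  define k where "k = max 1 c"
  have k: "0 < k" "1 \<le> k" "c \<le> k" by (auto simp: k_def)
  have "inf (k *\<^sub>R a) (k *\<^sub>R b) = 0" using scale_inf[OF k(1), of a b] assms(4) by simp
  then show ?thesis
  proof (rule disjoint_mono)
    show "a \<le> k *\<^sub>R a" using scale_left_mono[OF assms(1) k(2)] by simp
  qed (use assms k in \<open>auto intro: scale_nonneg scale_left_mono\<close>)
qed

lemma sum_nonneg_lat: "(\<And>a. a \<in> A \<Longrightarrow> 0 \<le> g a) \<Longrightarrow> 0 \<le> (sum g A :: 'a)"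
  by (induction A rule: infinite_finite_induct) (auto intro: lat.add_nonneg_nonneg)

lemma disjoint_sum:
  fixes a :: 'a
  assumes "0 \<le> a" "\<And>i. i \<in> A \<Longrightarrow> 0 \<le> g i" "\<And>i. i \<in> A \<Longrightarrow> inf a (g i) = 0"
  shows "inf a (sum g A) = 0"
  using assms
proof (induction A rule: infinite_finite_induct)
  case (insert i A)
  then show ?case by (simp add: disjoint_add sum_nonneg_lat)
qed (simp_all add: inf_absorb2)

text \<open>A sum of two elements equals their infimum plus their supremum, so the sum of disjoint
  elements is their supremum.\<close>

lemma disjoint_sum_le:
  fixes z :: 'a
  assumes "0 \<le> z" "\<And>i. i \<in> A \<Longrightarrow> 0 \<le> g i" "\<And>i. i \<in> A \<Longrightarrow> g i \<le> z"
    "pairwise (\<lambda>i j. inf (g i) (g j) = 0) A"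
  shows "sum g A \<le> z"
  using assms
proof (induction A rule: infinite_finite_induct)
  case (insert i A)
  have "inf (g i) (g j) = 0" if "j \<in> A" for j
    using insert.prems(4) insert.hyps that by (auto simp: pairwise_def)
  then have "inf (g i) (sum g A) = 0"
    using insert.prems by (intro disjoint_sum) auto
  moreover have "sum g A \<le> z"
    using insert.prems by (intro insert.IH) (auto simp: pairwise_def)
  ultimately show ?case
    using insert.prems(3)[of i] insert.hyps lat.add_eq_inf_sup[of "g i" "sum g A"] by simp
qed simp_all

section \<open>Atoms and their multiples\<close>

text \<open>Stated through disjointness; that the order interval from 0 to \<open>a\<close> consists
  of multiples of \<open>a\<close> is derived in \<open>atom_multiple\<close>.\<close>

definition atom :: "'a \<Rightarrow> bool" where
  "atom a \<longleftrightarrow> 0 < a \<and>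
     (\<forall>v w. 0 \<le> v \<and> v \<le> a \<and> 0 \<le> w \<and> w \<le> a \<and> inf v w = 0 \<longrightarrow> v = 0 \<or> w = 0)"

lemma atomD:
  assumes "atom a" "0 \<le> v" "v \<le> a" "0 \<le> w" "w \<le> a" "inf v w = 0"
  shows "v = 0 \<or> w = 0"
  using assms unfolding atom_def by blast

lemma atom_pos: "atom a \<Longrightarrow> 0 < a"
  by (simp add: atom_def)

text \<open>The positive and negative parts of \<open>v - c *\<^sub>R a\<close> are disjoint.
  Divided by a large \<open>k\<close> both lie below \<open>a\<close>, so one of them
  vanishes.\<close>

lemma atom_comparable:
  assumes a: "atom a" and v: "0 \<le> v" "v \<le> a" and c: "0 \<le> c"
  shows "v \<le> c *\<^sub>R a \<or> c *\<^sub>R a \<le> v"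
proof -
  define k where "k = max 1 c"
  have k: "0 < k" "1 \<le> k" "c \<le> k" by (auto simp: k_def)
  have a0: "0 \<le> a" using atom_pos[OF a] by (rule order.strict_implies_order)
  let ?p = "sup (v - c *\<^sub>R a) 0" and ?q = "sup (c *\<^sub>R a - v) 0"
  have ca: "0 \<le> c *\<^sub>R a" using a0 c by (rule scale_nonneg)
  have "v - c *\<^sub>R a \<le> v" using ca by (simp add: lat.diff_le_eq)
  also have "v \<le> k *\<^sub>R a" using v(2) scale_left_mono[OF a0 k(2)] by simp
  finally have p: "?p \<le> k *\<^sub>R a" using scale_nonneg[OF a0, of k] k(1) by simp
  have "c *\<^sub>R a - v \<le> c *\<^sub>R a" using v(1) by (simp add: lat.diff_le_eq)
  also have "\<dots> \<le> k *\<^sub>R a" using scale_left_mono[OF a0 k(3)] .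
  finally have q: "?q \<le> k *\<^sub>R a" using scale_nonneg[OF a0, of k] k(1) by simp
  have "inf ?p ?q = 0" using inf_positive_negative_part[of "v - c *\<^sub>R a"] by simp
  then have "inf ((1/k) *\<^sub>R ?p) ((1/k) *\<^sub>R ?q) = 0"
    using scale_inf[of "1/k" ?p ?q] k(1) by simp
  moreover have "(1/k) *\<^sub>R ?p \<le> a" "(1/k) *\<^sub>R ?q \<le> a"
    using scale_mono[OF p, of "1/k"] scale_mono[OF q, of "1/k"] k(1) by simp_all
  moreover have "0 \<le> (1/k) *\<^sub>R ?p" "0 \<le> (1/k) *\<^sub>R ?q"
    using k(1) by (auto intro: scale_nonneg)
  ultimately have "(1/k) *\<^sub>R ?p = 0 \<or> (1/k) *\<^sub>R ?q = 0"
    by (intro atomD[OF a])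
  then have "?p = 0 \<or> ?q = 0" using k(1) by simp
  then have "v - c *\<^sub>R a \<le> 0 \<or> c *\<^sub>R a - v \<le> 0" by (metis sup.cobounded1)
  then show ?thesis by simp
qed

text \<open>Let \<open>c\<close> be the largest multiplier with
  \<open>c *\<^sub>R a \<le> v\<close>. Any larger multiple fails to lie below \<open>v\<close>, so
  by comparability it lies above.\<close>

lemma atom_multiple:
  assumes a: "atom a" and v: "0 \<le> v" "v \<le> a"
  obtains c where "0 \<le> c" "v = c *\<^sub>R a"
proof -
  have a0: "0 < a" using a by (simp add: atom_def)
  obtain c where c: "0 \<le> c" "c *\<^sub>R a \<le> v" and max: "\<And>d. d *\<^sub>R a \<le> v \<Longrightarrow> d \<le> c"
    by (rule maximal_multiple[OF a0 v(1)]) (rule that)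
  have "v \<le> c *\<^sub>R a"
  proof (rule le_archimedean[of a])
    fix e :: real assume e: "0 < e"
    then have "\<not> (c + e) *\<^sub>R a \<le> v" using max[of "c + e"] by auto
    then have "v \<le> (c + e) *\<^sub>R a" using atom_comparable[OF a v, of "c + e"] c(1) e by auto
    then show "v \<le> c *\<^sub>R a + e *\<^sub>R a" by (simp add: scaleR_left_distrib)
  qed (use a0 in simp)
  then show thesis using that c order.antisym by blast
qed

section \<open>Infinite disjoint systems from infinite dimension\<close>

definition disjoint_system :: "'a set \<Rightarrow> bool" where
  "disjoint_system D \<longleftrightarrow> (\<forall>x\<in>D. 0 < x) \<and> pairwise (\<lambda>x y. inf x y = 0) D"

lemma disjoint_system_pos: "disjoint_system D \<Longrightarrow> x \<in> D \<Longrightarrow> 0 < x"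
  by (simp add: disjoint_system_def)

lemma disjoint_system_disjoint: "disjoint_system D \<Longrightarrow> x \<in> D \<Longrightarrow> y \<in> D \<Longrightarrow> x \<noteq> y \<Longrightarrow> inf x y = 0"
  unfolding disjoint_system_def by (blast dest: pairwiseD)

text \<open>A non-atom contains two disjoint nonzero pieces. One, \<open>V w\<close>, is kept and
  the other, \<open>W w\<close>, is split again.\<close>

lemma infinite_disjoint_system_if_no_atom:
  fixes u :: 'a
  assumes u: "0 < u" and noatom: "\<And>a. a \<le> u \<Longrightarrow> \<not> atom a"
  obtains D where "disjoint_system D" "infinite D"
proof -
  define P where "P w \<longleftrightarrow> 0 < w \<and> w \<le> u" for w :: 'a
  have "\<exists>v w'. P w' \<and> w' \<le> w \<and> 0 < v \<and> v \<le> w \<and> inf v w' = 0" if "P w" for w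
  proof -
    have "0 < w" "\<not> atom w" using that noatom by (auto simp: P_def)
    then obtain v w' where *: "0 \<le> v" "v \<le> w" "0 \<le> w'" "w' \<le> w" "inf v w' = 0" "v \<noteq> 0" "w' \<noteq> 0"
      unfolding atom_def by blast
    moreover have "w' \<le> u" using * that order.trans unfolding P_def by blast
    moreover have "0 < v" "0 < w'" using * by (simp_all add: order.strict_iff_order)
    ultimately show ?thesis unfolding P_def by blast
  qed
  then obtain V W where VW: "\<And>w. P w \<Longrightarrow> P (W w)" "\<And>w. P w \<Longrightarrow> W w \<le> w"
    "\<And>w. P w \<Longrightarrow> 0 < V w" "\<And>w. P w \<Longrightarrow> V w \<le> w" "\<And>w. P w \<Longrightarrow> inf (V w) (W w) = 0"
    by metis
  define w where "w n = (W ^^ n) u" for n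
  have Pw: "P (w n)" for n
    by (induction n) (use u VW(1) in \<open>simp_all add: w_def P_def\<close>)
  have wSuc: "w (Suc n) = W (w n)" for n by (simp add: w_def)
  have decr: "w m \<le> w n" if "n \<le> m" for m n
    using that
  proof (induction rule: dec_induct)
    case (step m)
    then show ?case using VW(2)[OF Pw] wSuc order.trans by metis
  qed simp
  \<comment> \<open>All later pieces lie below \<open>w (Suc n)\<close>, which is disjoint from the
    piece kept at stage \<open>n\<close>.\<close>
  have disj: "inf (V (w n)) (V (w m)) = 0" if "n < m" for n m
  proof (rule disjoint_mono)
    show "inf (V (w n)) (w (Suc n)) = 0" using VW(5)[OF Pw] wSuc by simp
    show "V (w m) \<le> w (Suc n)" using order.trans[OF VW(4)[OF Pw] decr] that by simp
    show "0 \<le> V (w n)" "0 \<le> V (w m)" using VW(3)[OF Pw] by (simp_all add: order.strict_implies_order)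
  qed simp
  then have disj': "inf (V (w n)) (V (w m)) = 0" if "n \<noteq> m" for n m
    using that by (metis inf_commute linorder_neqE_nat)
  have "inj (\<lambda>n. V (w n))"
  proof (rule injI, rule ccontr)
    fix m n assume "V (w m) = V (w n)" "m \<noteq> n"
    then have "V (w n) = 0" using disj'[of m n] by simp
    then show False using VW(3)[OF Pw, of n] by simp
  qed
  then have "infinite (range (\<lambda>n. V (w n)))" using finite_imageD by blast
  moreover have "disjoint_system (range (\<lambda>n. V (w n)))"
    unfolding disjoint_system_def
  proof (intro conjI ballI pairwiseI)
    fix x assume "x \<in> range (\<lambda>n. V (w n))"
    then show "0 < x" using VW(3)[OF Pw] by blast
  next
    fix x y assume "x \<in> range (\<lambda>n. V (w n))" "y \<in> range (\<lambda>n. V (w n))" and ne: "x \<noteq> y"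
    then obtain m n where "x = V (w m)" "y = V (w n)" by blast
    moreover from this have "m \<noteq> n" using ne by blast
    ultimately show "inf x y = 0" using disj'[of m n] by simp
  qed
  ultimately show thesis using that by blast
qed

text \<open>Zorn's lemma: an atom disjoint from all members could be added to a maximal
  system.\<close>

lemma maximal_atom_system:
  obtains A where "disjoint_system A" "\<And>a. a \<in> A \<Longrightarrow> atom a"
    "\<And>b. atom b \<Longrightarrow> \<exists>a\<in>A. inf a b \<noteq> 0"
proof -
  let ?\<A> = "{A. disjoint_system A \<and> (\<forall>a\<in>A. atom a)}"
  have "\<exists>M\<in>?\<A>. \<forall>X\<in>?\<A>. M \<subseteq> X \<longrightarrow> X = M"
  proof (rule subset_Zorn')
    fix \<C> assume ch: "subset.chain ?\<A> \<C>"
    have "disjoint_system (\<Union>\<C>)"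
      unfolding disjoint_system_def pairwise_def
    proof (intro conjI ballI impI)
      fix x assume "x \<in> \<Union>\<C>"
      then obtain X where "X \<in> \<C>" "x \<in> X" by blast
      moreover from this have "disjoint_system X" using ch unfolding subset_chain_def by blast
      ultimately show "0 < x" using disjoint_system_pos by blast
    next
      fix x y assume "x \<in> \<Union>\<C>" "y \<in> \<Union>\<C>" and ne: "x \<noteq> y"
      then obtain X Y where XY: "X \<in> \<C>" "Y \<in> \<C>" "x \<in> X" "y \<in> Y" by blast
      have "X \<subseteq> Y \<or> Y \<subseteq> X" using ch XY unfolding subset_chain_def by blast
      then obtain Z where "Z \<in> \<C>" "x \<in> Z" "y \<in> Z" using XY by blast
      moreover from this have "disjoint_system Z" using ch unfolding subset_chain_def by blast
      ultimately show "inf x y = 0" using ne disjoint_system_disjoint by blast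
    qed
    moreover have "\<forall>a\<in>\<Union>\<C>. atom a" using ch unfolding subset_chain_def by blast
    ultimately show "\<Union>\<C> \<in> ?\<A>" by blast
  qed
  then obtain A where A: "disjoint_system A" "\<And>a. a \<in> A \<Longrightarrow> atom a"
    and max: "\<And>X. X \<in> ?\<A> \<Longrightarrow> A \<subseteq> X \<Longrightarrow> X = A"
    by auto
  have "\<exists>a\<in>A. inf a b \<noteq> 0" if b: "atom b" for b
  proof (rule ccontr)
    assume "\<not> (\<exists>a\<in>A. inf a b \<noteq> 0)"
    then have d: "\<And>a. a \<in> A \<Longrightarrow> inf a b = 0" by blast
    have b0: "0 < b" using b by (simp add: atom_def)
    have "disjoint_system (insert b A)"
      using A(1) d b0 unfolding disjoint_system_def pairwise_insert
      by (auto simp: inf_commute)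
    then have "insert b A = A" using b A(2) by (intro max) auto
    then have "inf b b = 0" using d[of b] by blast
    then show False using b0 by simp
  qed
  with A show thesis using that by blast
qed

text \<open>From \<open>x \<ge> 0\<close> the largest multiple of each atom in \<open>A\<close> is
  subtracted. A nonzero remainder would have an atom below it, which meets some \<open>a\<close> in
  \<open>A\<close> in a positive multiple of \<open>a\<close>, so the multiplier of \<open>a\<close>
  was not the largest.\<close>

lemma span_atom_system:
  assumes fin: "finite A" and A: "disjoint_system A" "\<And>a. a \<in> A \<Longrightarrow> atom a"
    and max: "\<And>b. atom b \<Longrightarrow> \<exists>a\<in>A. inf a b \<noteq> 0"
    and below: "\<And>u. 0 < u \<Longrightarrow> \<exists>a\<le>u. atom a"
  shows "span A = (UNIV :: 'a set)"
proof -
  have pos: "x \<in> span A" if x: "0 \<le> x" for x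
  proof -
    have apos: "0 < a" if "a \<in> A" for a using A(1) that by (simp add: disjoint_system_def)
    have "\<exists>c. 0 \<le> c \<and> c *\<^sub>R a \<le> x \<and> (\<forall>d. d *\<^sub>R a \<le> x \<longrightarrow> d \<le> c)" if "a \<in> A" for a
      using maximal_multiple[OF apos[OF that] x] by metis
    then obtain c where c: "\<And>a. a \<in> A \<Longrightarrow> 0 \<le> c a" "\<And>a. a \<in> A \<Longrightarrow> c a *\<^sub>R a \<le> x"
      "\<And>a d. a \<in> A \<Longrightarrow> d *\<^sub>R a \<le> x \<Longrightarrow> d \<le> c a"
      by metis
    let ?s = "\<Sum>a\<in>A. c a *\<^sub>R a"
    have nn: "0 \<le> c a *\<^sub>R a" if "a \<in> A" for a
      using c(1)[OF that] apos[OF that] by (intro scale_nonneg) auto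
    have s: "?s \<le> x"
    proof (rule disjoint_sum_le[OF x nn c(2)])
      show "pairwise (\<lambda>a b. inf (c a *\<^sub>R a) (c b *\<^sub>R b) = 0) A"
      proof (rule pairwiseI)
        fix a b assume ab: "a \<in> A" "b \<in> A" "a \<noteq> b"
        have a0: "0 \<le> a" and b0: "0 \<le> b" using apos ab by (auto intro: order.strict_implies_order)
        have "inf b a = 0" using disjoint_system_disjoint[OF A(1) ab(2,1)] ab(3) by simp
        then have "inf b (c a *\<^sub>R a) = 0" using a0 b0 c(1)[OF ab(1)] by (intro disjoint_scaleR)
        then have "inf (c a *\<^sub>R a) b = 0" by (simp add: inf_commute)
        then show "inf (c a *\<^sub>R a) (c b *\<^sub>R b) = 0"
          using nn[OF ab(1)] b0 c(1)[OF ab(2)] by (intro disjoint_scaleR)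
      qed
    qed
    have "x - ?s = 0"
    proof (rule ccontr)
      assume "x - ?s \<noteq> 0"
      then have "0 < x - ?s" using s by (simp add: order.strict_iff_order)
      then obtain b where b: "b \<le> x - ?s" "atom b" using below by blast
      obtain a where a: "a \<in> A" "inf a b \<noteq> 0" using max[OF b(2)] by blast
      have "0 \<le> inf a b" using apos[OF a(1)] b(2) by (simp add: atom_def order.strict_implies_order)
      then obtain e where e: "0 \<le> e" "inf a b = e *\<^sub>R a"
        using atom_multiple[OF A(2)[OF a(1)]] inf.cobounded1 by blast
      have "e \<noteq> 0" using e a(2) by auto
      have "e *\<^sub>R a \<le> x - ?s" using e(2) b(1) inf.cobounded2[of a b] by (metis order.trans)
      moreover have "c a *\<^sub>R a \<le> ?s"
        using sum.remove[OF fin a(1), of "\<lambda>a. c a *\<^sub>R a"] sum_nonneg_lat[of "A - {a}" "\<lambda>a. c a *\<^sub>R a"] nn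
        by (simp add: lat.add_increasing2)
      ultimately have "c a *\<^sub>R a + e *\<^sub>R a \<le> ?s + (x - ?s)" by (intro lat.add_mono)
      then have "(c a + e) *\<^sub>R a \<le> x" by (simp add: scaleR_left_distrib)
      then have "c a + e \<le> c a" by (rule c(3)[OF a(1)])
      then show False using e(1) \<open>e \<noteq> 0\<close> by simp
    qed
    then have "x = ?s" by simp
    moreover have "?s \<in> span A" by (intro span_sum span_scale span_base)
    ultimately show ?thesis by simp
  qed
  have "x \<in> span A" for x
  proof -
    have "x + sup (- x) 0 = sup x 0"
      by (simp add: lat.add_sup_distrib_left sup_commute)
    then have "sup x 0 - sup (- x) 0 = x" by (metis add_diff_cancel_right')
    moreover have "sup x 0 - sup (- x) 0 \<in> span A" by (intro span_diff pos) auto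
    ultimately show ?thesis by simp
  qed
  then show ?thesis by blast
qed

text \<open>If all disjoint systems were finite, every positive element would have an atom below it
  and a maximal system of atoms would be a finite spanning set.\<close>

lemma infinite_disjoint_system:
  assumes "infinite_dimensional TYPE('a)"
  obtains D where "disjoint_system D" "infinite D"
proof (rule ccontr)
  assume "\<not> thesis"
  with that have fin: "\<And>D. disjoint_system D \<Longrightarrow> finite D" by blast
  obtain A where A: "disjoint_system A" "\<And>a. a \<in> A \<Longrightarrow> atom a"
    "\<And>b. atom b \<Longrightarrow> \<exists>a\<in>A. inf a b \<noteq> 0"
    by (rule maximal_atom_system) (rule that)
  have span: "span A = UNIV"
  proof (rule span_atom_system[OF fin[OF A(1)] A(1)])
    show "\<exists>a\<le>u. atom a" if "0 < u" for u
      using infinite_disjoint_system_if_no_atom[OF that] fin by metis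
  qed (use A in auto)
  obtain S :: "'a set" where "independent S" "infinite S"
    using assms unfolding infinite_dimensional_def by blast
  then show False using independent_span_bound[OF fin[OF A(1)]] span by blast
qed

text \<open>Otherwise \<open>e / \<epsilon>\<close> would dominate the whole unit ball, and the partial sums of a
  normalised disjoint sequence would be a bounded increasing sequence that does not converge.\<close>

lemma positive_functional_small_at:
  assumes refl: "reflexive_space TYPE('a)" and inf: "infinite_dimensional TYPE('a)"
    and e: "0 \<le> e" and \<epsilon>: "0 < \<epsilon>"
  obtains h :: "'a \<Rightarrow>\<^sub>L real" where "positive_functional h" "norm h = 1" "h e < \<epsilon>"
proof (rule ccontr)
  assume "\<not> thesis"
  with that have big: "\<epsilon> \<le> h e" if "positive_functional h" "norm h = 1" for h :: "'a \<Rightarrow>\<^sub>L real"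
    using \<open>positive_functional h\<close> \<open>norm h = 1\<close> by (meson not_le)
  \<comment> \<open>Obtained by applying \<open>big\<close> to the normalised functional.\<close>
  have norm_le: "norm f \<le> f ((1/\<epsilon>) *\<^sub>R e)" if f: "positive_functional f" for f :: "'a \<Rightarrow>\<^sub>L real"
  proof (cases "f = 0")
    case False
    then have n: "0 < norm f" by simp
    have "positive_functional (f /\<^sub>R norm f)"
      using f n unfolding positive_functional_def by (simp add: blinfun.scaleR_left)
    moreover have "norm (f /\<^sub>R norm f) = 1" using n by simp
    ultimately have "\<epsilon> \<le> (f /\<^sub>R norm f) e" by (rule big)
    then have "\<epsilon> * norm f \<le> f e" using n by (simp add: blinfun.scaleR_left field_simps)
    then show ?thesis using \<epsilon> by (simp add: blinfun.scaleR_right field_simps)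
  qed simp
  obtain D where D: "disjoint_system D" "infinite D"
    by (rule infinite_disjoint_system[OF inf])
  obtain w :: "nat \<Rightarrow> 'a" where w: "inj w" "range w \<subseteq> D"
    using infinite_countable_subset[OF D(2)] by blast
  have wpos: "0 < w n" for n using disjoint_system_pos[OF D(1)] w(2) by blast
  have wdisj: "inf (w m) (w n) = 0" if "m \<noteq> n" for m n
  proof -
    have "w m \<noteq> w n" using w(1) that by (simp add: inj_eq)
    then show ?thesis using disjoint_system_disjoint[OF D(1)] w(2) by blast
  qed
  define u where "u n = w n /\<^sub>R norm (w n)" for n
  have nw: "0 < norm (w n)" for n using wpos[of n] by auto
  have u1: "norm (u n) = 1" for n using nw[of n] by (simp add: u_def)
  have u0: "0 \<le> u n" for n
    using wpos[of n] unfolding u_def by (intro scale_nonneg) auto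
  have udisj: "inf (u m) (u n) = 0" if "m \<noteq> n" for m n
  proof -
    have w0: "0 \<le> w k" for k using wpos[of k] by simp
    have "inf (w n) (u m) = 0"
      using that unfolding u_def by (intro disjoint_scaleR w0 wdisj) auto
    then have "inf (u m) (w n) = 0" by (simp add: inf_commute)
    then show ?thesis
      using u0[of m] w0[of n] unfolding u_def[of n] by (intro disjoint_scaleR) auto
  qed
  have z: "0 \<le> (1/\<epsilon>) *\<^sub>R e" using e \<epsilon> by (intro scale_nonneg) auto
  have uz: "u n \<le> (1/\<epsilon>) *\<^sub>R e" for n
  proof (rule le_if_positive_functionals)
    fix f :: "'a \<Rightarrow>\<^sub>L real" assume "positive_functional f"
    then show "f (u n) \<le> f ((1/\<epsilon>) *\<^sub>R e)"
      using norm_le[of f] norm_blinfun[of f "u n"] u1[of n] by simp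
  qed
  have sz: "(\<Sum>i<n. u i) \<le> (1/\<epsilon>) *\<^sub>R e" for n
    \<comment> \<open>Disjointness lets one bound for the single terms bound all partial
      sums.\<close>
    using z u0 uz udisj by (intro disjoint_sum_le) (auto simp: pairwise_def)
  have "norm (\<Sum>i<n. u i) \<le> norm ((1/\<epsilon>) *\<^sub>R e)" for n
    using u0 sz by (intro norm_mono sum_nonneg_lat)
  then show False
    by (rule no_separated_increasing_sequence[OF refl, of "\<lambda>n. \<Sum>i<n. u i" _ u]) (simp_all add: u0 u1)
qed

subsection \<open>Baire category in the positive part of the dual ball\<close>

definition positive_dual_ball :: "('a \<Rightarrow> real) set" where
  "positive_dual_ball = {blinfun_apply f | f :: 'a \<Rightarrow>\<^sub>L real. positive_functional f \<and> norm f \<le> 1}"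

lemma compact_positive_dual_ball: "compact positive_dual_ball"
proof -
  have cl: "closed (\<Inter>x\<in>{0..}. {y :: 'a \<Rightarrow> real. 0 \<le> y x})"
    by (intro closed_INT ballI closed_Collect_le continuous_on_const continuous_on_product_coordinates)
  have eq: "positive_dual_ball = blinfun_apply ` cball 0 1 \<inter> (\<Inter>x\<in>{0..}. {y. 0 \<le> y x})"
    by (auto simp: positive_dual_ball_def positive_functional_def)
  show ?thesis
    unfolding eq by (rule compact_Int_closed[OF compact_dual_ball cl])
qed

text \<open>Baire's theorem for a compact Hausdorff space, with density tested on open sets of the
  ambient product.\<close>

lemma positive_dual_ball_Baire:
  assumes "countable \<G>" "\<G> \<noteq> {}"
    and "\<And>G. G \<in> \<G> \<Longrightarrow> openin (top_of_set positive_dual_ball) G"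
    and dense: "\<And>G U y. G \<in> \<G> \<Longrightarrow> open U \<Longrightarrow> y \<in> positive_dual_ball \<Longrightarrow> y \<in> U \<Longrightarrow> G \<inter> U \<noteq> {}"
  shows "\<Inter>\<G> \<inter> positive_dual_ball \<noteq> {}"
proof -
  let ?X = "top_of_set positive_dual_ball"
  have "Hausdorff_space (euclidean :: ('a \<Rightarrow> real) topology)"
    unfolding euclidean_product_topology[symmetric] by (simp add: Hausdorff_space_product_topology)
  then have "Hausdorff_space ?X" by (rule Hausdorff_space_subtopology)
  moreover have "compact_space ?X"
    using compact_positive_dual_ball by (simp add: compact_space_subtopology)
  ultimately have X: "locally_compact_space ?X \<and> regular_space ?X"
    by (simp add: compact_imp_locally_compact_space compact_Hausdorff_imp_regular_space)
  have "?X closure_of \<Inter>\<G> = topspace ?X"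
  proof (rule Baire_category)
    show "openin ?X G \<and> ?X closure_of G = topspace ?X" if G: "G \<in> \<G>" for G
    proof (intro conjI)
      show "openin ?X G" by (rule assms(3)[OF G])
      then have sub: "G \<subseteq> positive_dual_ball" by (simp add: openin_imp_subset)
      show "?X closure_of G = topspace ?X"
        unfolding dense_intersects_open
      proof (intro allI impI)
        fix V assume "openin ?X V \<and> V \<noteq> {}"
        then obtain U where U: "open U" "V = positive_dual_ball \<inter> U" and "V \<noteq> {}"
          by (auto simp: openin_open)
        then obtain y where "y \<in> positive_dual_ball" "y \<in> U" by blast
        then have "G \<inter> U \<noteq> {}" using dense[OF G U(1)] by blast
        then show "G \<inter> V \<noteq> {}" using sub U(2) by blast
      qed
    qed
  qed (use X assms in auto)
  \<comment> \<open>The zero functional shows that the space is nonempty, so a dense intersection is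
    nonempty too.\<close>
  moreover have "blinfun_apply 0 \<in> topspace ?X"
    unfolding positive_dual_ball_def by (force simp: positive_functional_def)
  ultimately have "?X closure_of \<Inter>\<G> \<noteq> {}" by blast
  moreover have "topspace ?X \<inter> \<Inter>\<G> = {} \<Longrightarrow> ?X closure_of \<Inter>\<G> = {}"
    by (metis closure_of_empty closure_of_restrict)
  ultimately show ?thesis by auto
qed

lemma abs_positive_functional_le:
  fixes h :: "'a \<Rightarrow>\<^sub>L real"
  assumes "positive_functional h"
  shows "\<bar>h x\<bar> \<le> h (lat_abs x)"
  using positive_functional_mono[OF assms, of x "lat_abs x"]
    positive_functional_mono[OF assms, of "- x" "lat_abs x"]
  by (simp add: lat_abs_def blinfun.minus_right)

lemma positive_functional_add_scaleR:
  fixes f h :: "'a \<Rightarrow>\<^sub>L real"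
  assumes "positive_functional f" "positive_functional h" "0 \<le> t"
  shows "positive_functional (f + t *\<^sub>R h)"
  using assms unfolding positive_functional_def by (simp add: blinfun.add_left blinfun.scaleR_left)

text \<open>Adding a positive functional that is small at finitely many points moves \<open>y\<close> to the unit sphere
  without leaving \<open>U\<close>.\<close>

lemma positive_dual_sphere_dense:
  assumes refl: "reflexive_space TYPE('a)" and inf: "infinite_dimensional TYPE('a)"
    and U: "open U" "y \<in> U" and y: "y \<in> positive_dual_ball"
  obtains g :: "'a \<Rightarrow>\<^sub>L real" where "positive_functional g" "norm g = 1" "blinfun_apply g \<in> U"
proof -
  obtain f :: "'a \<Rightarrow>\<^sub>L real" where f: "positive_functional f" "norm f \<le> 1" "y = blinfun_apply f"
    using y unfolding positive_dual_ball_def by blast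
  have "openin (product_topology (\<lambda>_. euclidean) UNIV) U"
    using U(1) by (simp add: euclidean_product_topology)
  from product_topology_open_contains_basis[OF this U(2)]
  \<comment> \<open>A basic neighbourhood restricts only finitely many coordinates; these form
    \<open>I\<close>.\<close>
  obtain X where X: "y \<in> Pi\<^sub>E UNIV X" "\<And>i. open (X i)" "finite {i. X i \<noteq> UNIV}" "Pi\<^sub>E UNIV X \<subseteq> U"
    by auto
  define I where "I = {i. X i \<noteq> UNIV}"
  have "\<exists>r>0. ball (y i) r \<subseteq> X i" for i
    using X(1,2) open_contains_ball by (metis PiE_mem UNIV_I)
  then obtain r where r: "\<And>i. 0 < r i" "\<And>i. ball (y i) (r i) \<subseteq> X i" by metis
  define \<epsilon> where "\<epsilon> = Min (insert 1 (r ` I))"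
  have finI: "finite I" using X(3) by (simp add: I_def)
  have \<epsilon>: "0 < \<epsilon>" "\<And>i. i \<in> I \<Longrightarrow> \<epsilon> \<le> r i"
    using finI r(1) by (auto simp: \<epsilon>_def)
  \<comment> \<open>One element dominating \<open>lat_abs i\<close> for every \<open>i\<close> in
    \<open>I\<close>: smallness of \<open>h\<close> at \<open>e\<close> controls all these
    coordinates.\<close>
  define e where "e = (\<Sum>i\<in>I. lat_abs i)"
  have "0 \<le> e" unfolding e_def by (intro sum_nonneg_lat lat_abs_nonneg)
  then obtain h :: "'a \<Rightarrow>\<^sub>L real" where h: "positive_functional h" "norm h = 1" "h e < \<epsilon> / 2"
    using positive_functional_small_at[OF refl inf, of e "\<epsilon> / 2"] \<epsilon>(1) by auto
  have hi: "\<bar>h i\<bar> < \<epsilon> / 2" if "i \<in> I" for i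
  proof -
    have "lat_abs i \<le> e"
      unfolding e_def using sum.remove[OF finI that, of lat_abs]
        sum_nonneg_lat[of "I - {i}" lat_abs] lat_abs_nonneg
      by (simp add: lat.add_increasing2)
    then have "h (lat_abs i) \<le> h e" by (rule positive_functional_mono[OF h(1)])
    then show ?thesis using abs_positive_functional_le[OF h(1), of i] h(3) by linarith
  qed
  \<comment> \<open>The norm is at most 1 at \<open>t = 0\<close> and at least \<open>2 - 1\<close>
    at \<open>t = 2\<close>, so it equals 1 in between. As \<open>t \<le> 2\<close>, the bound
    \<open>\<epsilon> / 2\<close> on \<open>h\<close> keeps the perturbation below
    \<open>\<epsilon>\<close>.\<close>
  have "1 \<le> norm (f + 2 *\<^sub>R h)"
    using norm_diff_ineq[of "2 *\<^sub>R h" f] f(2) h(2) by (simp add: add.commute)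
  moreover have "continuous_on {0..2} (\<lambda>t. norm (f + t *\<^sub>R h))"
    by (intro continuous_intros)
  ultimately obtain t where t: "0 \<le> t" "t \<le> 2" "norm (f + t *\<^sub>R h) = 1"
    using IVT'[of "\<lambda>t. norm (f + t *\<^sub>R h)" 0 1 2] f(2) by auto
  have "(f + t *\<^sub>R h) i \<in> X i" for i
  proof (cases "i \<in> I")
    case True
    have "t * \<bar>h i\<bar> \<le> 2 * \<bar>h i\<bar>" using t by (intro mult_right_mono) auto
    then have "\<bar>t * h i\<bar> < r i" using hi[OF True] \<epsilon>(2)[OF True] t(1) by (simp add: abs_mult)
    then have "(f + t *\<^sub>R h) i \<in> ball (y i) (r i)"
      by (simp add: f(3) dist_real_def blinfun.add_left blinfun.scaleR_left)
    then show ?thesis using r(2) by blast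
  qed (simp add: I_def)
  then have "blinfun_apply (f + t *\<^sub>R h) \<in> U" using X(4) by (auto simp: PiE_def)
  then show thesis
    using that t positive_functional_add_scaleR[OF f(1) h(1) t(1)] by blast
qed

text \<open>A functional with value 1 at \<open>a\<close> is moved off that level by a factor
  slightly below 1, which keeps it in the positive ball.\<close>

lemma positive_dual_ball_avoid_level_dense:
  assumes U: "open U" "y \<in> U" and y: "y \<in> positive_dual_ball"
  shows "{z \<in> positive_dual_ball. z a \<noteq> 1} \<inter> U \<noteq> {}"
proof (cases "y a = 1")
  case True
  obtain f :: "'a \<Rightarrow>\<^sub>L real" where f: "positive_functional f" "norm f \<le> 1" "y = blinfun_apply f"
    using y unfolding positive_dual_ball_def by blast
  have "continuous_on UNIV (\<lambda>t x. t * y x)"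
    by (intro continuous_on_coordinatewise_then_product continuous_intros)
  then have "open ((\<lambda>t x. t * y x) -` U)" using U(1) by (simp add: continuous_on_open_vimage)
  moreover have "1 \<in> (\<lambda>t x. t * y x) -` U" using U(2) by simp
  ultimately obtain d where d: "0 < d" "ball 1 d \<subseteq> (\<lambda>t x. t * y x) -` U"
    by (meson open_contains_ball)
  \<comment> \<open>The second entry stays within \<open>d\<close> of 1; the first keeps
    \<open>t\<close> nonnegative when \<open>d\<close> is large.\<close>
  define t where "t = max (1 / 2) (1 - d / 2)"
  have t: "0 \<le> t" "t < 1" "t \<in> ball 1 d" using d(1) by (auto simp: t_def dist_real_def max_def)
  have "blinfun_apply (t *\<^sub>R f) = (\<lambda>x. t * y x)" by (rule ext) (simp add: f(3) blinfun.scaleR_left)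
  moreover have "positive_functional (t *\<^sub>R f)"
    using f(1) t(1) unfolding positive_functional_def by (simp add: blinfun.scaleR_left)
  moreover have "norm (t *\<^sub>R f) \<le> 1"
    using f(2) t mult_mono[of t 1 "norm f" 1] by simp
  ultimately have "(\<lambda>x. t * y x) \<in> positive_dual_ball"
    unfolding positive_dual_ball_def by (metis (mono_tags, lifting) mem_Collect_eq)
  moreover have "(\<lambda>x. t * y x) \<in> U" using t(3) d(2) by blast
  moreover have "t * y a \<noteq> 1" using True t(2) by simp
  ultimately show ?thesis by blast
qed (use U y in blast)

section \<open>The category argument\<close>

lemma uncountable_order_extreme_points:
  assumes refl: "reflexive_space TYPE('a)" and inf: "infinite_dimensional TYPE('a)"
  shows "uncountable {a::'a. order_extreme_point (cball 0 1) a}"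
proof
  let ?E = "{a::'a. order_extreme_point (cball 0 1) a}"
  assume count: "countable ?E"
  \<comment> \<open>Membership in every \<open>G n\<close> means norm one, so the \<open>G n\<close>
    exhibit the sphere as a countable intersection of open sets.\<close>
  define G where "G n = {y \<in> positive_dual_ball. \<exists>x\<in>cball 0 1. 1 - 1 / real (Suc n) < y x}" for n
  define H where "H a = {y \<in> positive_dual_ball. y a \<noteq> 1}" for a :: 'a
  have "\<Inter> (range G \<union> H ` ?E) \<inter> positive_dual_ball \<noteq> {}"
  proof (rule positive_dual_ball_Baire)
    show "countable (range G \<union> H ` ?E)" using count by simp
  next
    fix W assume "W \<in> range G \<union> H ` ?E"
    then consider n where "W = G n" | a where "W = H a" by blast
    then show "openin (top_of_set positive_dual_ball) W"
    proof cases
      case (1 n)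
      have "open (\<Union>x\<in>cball 0 1. {y :: 'a \<Rightarrow> real. 1 - 1 / real (Suc n) < y x})"
        by (intro open_UN ballI open_Collect_less continuous_on_const continuous_on_product_coordinates)
      moreover have "W = positive_dual_ball \<inter> (\<Union>x\<in>cball 0 1. {y. 1 - 1 / real (Suc n) < y x})"
        unfolding 1 G_def by blast
      ultimately show ?thesis by (simp add: openin_open_Int)
    next
      case (2 a)
      have "open {y :: 'a \<Rightarrow> real. y a \<noteq> 1}"
        by (intro open_Collect_neq continuous_on_const continuous_on_product_coordinates)
      moreover have "W = positive_dual_ball \<inter> {y. y a \<noteq> 1}" unfolding 2 H_def by blast
      ultimately show ?thesis by (simp add: openin_open_Int)
    qed
  next
    fix W U y assume W: "W \<in> range G \<union> H ` ?E"
      and U: "open U" and y: "y \<in> positive_dual_ball" "y \<in> U"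
    consider n where "W = G n" | a where "W = H a" using W by blast
    then show "W \<inter> U \<noteq> {}"
    proof cases
      case (1 n)
      \<comment> \<open>A norm-one functional in \<open>U\<close> lies in \<open>G n\<close> for
        each \<open>n\<close>.\<close>
      obtain g :: "'a \<Rightarrow>\<^sub>L real" where g: "positive_functional g" "norm g = 1" "blinfun_apply g \<in> U"
        by (rule positive_dual_sphere_dense[OF refl inf U y(2,1)])
      obtain x where "norm x \<le> 1" "1 - 1 / real (Suc n) < g x"
        by (rule blinfun_norm_approx[of "1 - 1 / real (Suc n)" g]) (use g(2) in auto)
      moreover have "blinfun_apply g \<in> positive_dual_ball"
        using g unfolding positive_dual_ball_def by auto
      ultimately have "blinfun_apply g \<in> G n" unfolding G_def by auto
      then show ?thesis using g(3) 1 by blast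
    next
      case (2 a)
      show ?thesis unfolding 2 H_def by (rule positive_dual_ball_avoid_level_dense[OF U y(2,1)])
    qed
  qed simp
  then obtain y where y: "\<And>n. y \<in> G n" "\<And>a. a \<in> ?E \<Longrightarrow> y \<in> H a" "y \<in> positive_dual_ball"
    by blast
  then obtain f :: "'a \<Rightarrow>\<^sub>L real" where f: "positive_functional f" "norm f \<le> 1" "y = blinfun_apply f"
    unfolding positive_dual_ball_def by blast
  obtain a where a: "order_extreme_point (cball 0 1) a" "\<And>x. norm x \<le> 1 \<Longrightarrow> f x \<le> f a"
    by (rule positive_functional_attains_at_order_extreme_point[OF refl f(1)]) (rule that)
  \<comment> \<open>The maximum \<open>f a\<close> of \<open>f\<close> over the ball is at least
    \<open>1 - 1 / real (Suc n)\<close> for each \<open>n\<close>. Hence \<open>f a = 1\<close>,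
    which \<open>H a\<close> forbids.\<close>
  have "1 \<le> f a"
  proof (rule field_le_epsilon)
    fix e :: real assume "0 < e"
    then obtain n where n: "1 / real (Suc n) < e" using reals_Archimedean[of e] by (auto simp: inverse_eq_divide)
    obtain x where "norm x \<le> 1" "1 - 1 / real (Suc n) < f x"
      using y(1)[of n] f(3) unfolding G_def by auto
    then show "1 \<le> f a + e" using a(2)[of x] n by linarith
  qed
  moreover have "f a \<le> norm f * norm a" using norm_blinfun[of f a] by simp
  moreover have "norm f * norm a \<le> 1 * 1"
    using f(2) a(1) unfolding order_extreme_point_def by (intro mult_mono) auto
  ultimately have "f a = 1" by linarith
  then show False using y(2)[of a] a(1) f(3) unfolding H_def by simp
qed

end

theorem mainTheorem18:
  assumes "banach_lattice TYPE('a::{banach,lattice})"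
    and "reflexive_space TYPE('a)"
    and "infinite_dimensional TYPE('a)"
  shows "uncountable {a::'a. order_extreme_point (cball 0 1) a}"
proof -
  interpret banach_lattice_type "TYPE('a)"
    by unfold_locales (rule assms(1))
  show ?thesis by (rule uncountable_order_extreme_points[OF assms(2,3)])
qed

end
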